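(* Let $C$ be a concept class over $X_d=\{0,1\}^d$. For every $\alpha,\beta,\epsilon$, there exists an $(\alpha,\beta,\epsilon,\delta=0,n,m)$-private semi-supervised learner (PSSL) for $C$ that is proper, where $$m=O\left(\frac{\mathrm{VC}(C)}{\alpha^3\epsilon}\log\Big(\frac1\alpha\Big)+\frac{1}{\alpha\epsilon}\log\Big(\frac1\beta\Big)\right),\qquad n=O\left(\frac{d\cdot \mathrm{VC}(C)}{\alpha^3\epsilon}\log\Big(\frac1\alpha\Big)+\frac{1}{\alpha\epsilon}\log\Big(\frac1\beta\Big)\right).$$ The learner might not be (computationally) efficient.
   Context: A concept over a domain $X$ is a function $c:X\to\{0,1\}$; a concept class is a set of concepts. $\mathrm{VC}(C)$ is the Vapnik–Chervonenkis dimension of $C$. For a distribution $\mu$ on $X$, $\mathrm{error}_\mu(c,h)=\Pr_{x\sim\mu}[h(x)\ne c(x)]$. Differential privacy: two databases of the same size are neighboring if they differ in exactly one entry. A randomized algorithm $\mathcal A$ is $(\epsilon,\delta)$-differentially private if for all neighboring databases $S_1,S_2$ and all sets $F$ of outputs, $\Pr[\mathcal A(S_1)\in F]\le e^{\epsilon}\Pr[\mathcal A(S_2)\in F]+\delta$ (probability over the coins of $\mathcal A$). Semi-supervised learner: an algorithm $\mathcal A$ is an $(\alpha,\beta,n,m)$-SSL for $C$ (with $m\le n$) if for every $c\in C$ and every distribution $\mu$ on $X$ the following holds: if $D=(x_i,y_i)_{i=1}^n\in(X\times\{0,1,\bot\})^n$ where the $x_i$ are i.i.d. from $\mu$, $y_i=c(x_i)$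 in the first $m$ entries, and $y_i=\bot$ in the last $n-m$ entries, then $\Pr[\mathcal A(D)=h \text{ with } \mathrm{error}_\mu(c,h)>\alpha]\le\beta$ (over the sample and the coins of $\mathcal A$). It is proper if it only outputs hypotheses in $C$. An $(\alpha,\beta,\epsilon,\delta,n,m)$-PSSL (private SSL) for $C$ is an algorithm with inputs in $(X\times\{0,1,\bot\})^n$ that is an $(\alpha,\beta,n,m)$-SSL for $C$ and is $(\epsilon,\delta)$-differentially private. *)

theory Defs
  imports "HOL-Probability.Probability"
begin

text \<open>
  A concept over a domain \<open>X\<close> is a function from \<open>X\<close> to \<open>{0,1}\<close>; it is represented by a
  boolean-valued extensional function, so that two concepts are equal iff they agree on \<open>X\<close>.
\<close>

definition concept_class :: "'x set \<Rightarrow> ('x \<Rightarrow> bool) set \<Rightarrow> bool" where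
  "concept_class X C \<longleftrightarrow> C \<subseteq> X \<rightarrow>\<^sub>E (UNIV :: bool set)"

definition cube :: "nat \<Rightarrow> bool list set" where
  "cube d = {x. length x = d}"

definition shatters :: "('x \<Rightarrow> bool) set \<Rightarrow> 'x set \<Rightarrow> bool" where
  "shatters C S \<longleftrightarrow> (\<forall>T\<subseteq>S. \<exists>c\<in>C. {x \<in> S. c x} = T)"

text \<open>
  Meant for finite \<open>X\<close> and nonempty \<open>C\<close>, where the maximum is taken over a finite set
  that contains \<open>0\<close> (the empty set is shattered).
\<close>

definition vc_dim :: "'x set \<Rightarrow> ('x \<Rightarrow> bool) set \<Rightarrow> nat" where
  "vc_dim X C = Max {card S | S. S \<subseteq> X \<and> shatters C S}"

definition pred_error :: "'x pmf \<Rightarrow> ('x \<Rightarrow> bool) \<Rightarrow> ('x \<Rightarrow> bool) \<Rightarrow> real" where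
  "pred_error \<mu> c h = measure_pmf.prob \<mu> {x. h x \<noteq> c x}"

definition databases :: "'r set \<Rightarrow> nat \<Rightarrow> 'r list set" where
  "databases R n = {D. length D = n \<and> set D \<subseteq> R}"

definition neighboring :: "'r list \<Rightarrow> 'r list \<Rightarrow> bool" where
  "neighboring D1 D2 \<longleftrightarrow>
     length D1 = length D2 \<and> card {i. i < length D1 \<and> D1 ! i \<noteq> D2 ! i} = 1"

definition differentially_private ::
    "'r list set \<Rightarrow> real \<Rightarrow> real \<Rightarrow> ('r list \<Rightarrow> 'o pmf) \<Rightarrow> bool" where
  "differentially_private DB \<epsilon> \<delta> A \<longleftrightarrow>
     (\<forall>D1\<in>DB. \<forall>D2\<in>DB. neighboring D1 D2 \<longrightarrow>
        (\<forall>F. measure_pmf.prob (A D1) F \<le> exp \<epsilon> * measure_pmf.prob (A D2) F + \<delta>))"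

text \<open>
  A randomized learner maps a database to the distribution of its output hypothesis.
  A label in \<open>{0,1,\<bottom>}\<close> is a \<open>bool option\<close>, with \<open>None\<close> for \<open>\<bottom>\<close>.
\<close>

type_synonym 'x learner = "('x \<times> bool option) list \<Rightarrow> ('x \<Rightarrow> bool) pmf"

definition semi_label :: "('x \<Rightarrow> bool) \<Rightarrow> nat \<Rightarrow> 'x list \<Rightarrow> ('x \<times> bool option) list" where
  "semi_label c m xs =
     map (\<lambda>x. (x, Some (c x))) (take m xs) @ map (\<lambda>x. (x, None)) (drop m xs)"

text \<open>
  In the following, the probability is over both the i.i.d. sample and the coins of the learner.
  Quantifying over probability mass functions supported on \<open>X\<close> covers all
  distributions on \<open>X\<close> when \<open>X\<close> is countable.
\<close>

definition SSL ::
    "'x set \<Rightarrow> ('x \<Rightarrow> bool) set \<Rightarrow> real \<Rightarrow> real \<Rightarrow> nat \<Rightarrow> nat \<Rightarrow> 'x learner \<Rightarrow> bool" where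
  "SSL X C \<alpha> \<beta> n m A \<longleftrightarrow>
     m \<le> n \<and>
     (\<forall>c\<in>C. \<forall>\<mu>. set_pmf \<mu> \<subseteq> X \<longrightarrow>
        measure_pmf.prob (bind_pmf (replicate_pmf n \<mu>) (\<lambda>xs. A (semi_label c m xs)))
          {h. pred_error \<mu> c h > \<alpha>} \<le> \<beta>)"

definition PSSL ::
    "'x set \<Rightarrow> ('x \<Rightarrow> bool) set \<Rightarrow> real \<Rightarrow> real \<Rightarrow> real \<Rightarrow> real \<Rightarrow> nat \<Rightarrow> nat
      \<Rightarrow> 'x learner \<Rightarrow> bool" where
  "PSSL X C \<alpha> \<beta> \<epsilon> \<delta> n m A \<longleftrightarrow>
     SSL X C \<alpha> \<beta> n m A \<and> differentially_private (databases (X \<times> UNIV) n) \<epsilon> \<delta> A"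

definition proper_learner ::
    "'x set \<Rightarrow> ('x \<Rightarrow> bool) set \<Rightarrow> nat \<Rightarrow> 'x learner \<Rightarrow> bool" where
  "proper_learner X C n A \<longleftrightarrow> (\<forall>D\<in>databases (X \<times> UNIV) n. set_pmf (A D) \<subseteq> C)"

end

theory Submission
  imports Defs
begin

text \<open>
  A list \<open>t\<close> of \<open>k\<close> points is chosen privately from the unlabeled part of the database, and the output
  is chosen privately, on the labeled part, among one representative in \<open>C\<close> of every labeling
  of \<open>t\<close>. Since the two parts are disjoint, the privacy losses do not add up. Both choices are made by the
  exponential mechanism, whose score for a candidate is the largest number of sample points in a
  set belonging to a family attached to the candidate: for \<open>t\<close>, the sets \<open>{x. c x \<noteq> c' x}\<close> with
  \<open>c\<close>, \<open>c'\<close> in \<open>C\<close> equal on \<open>t\<close>; for a hypothesis \<open>h\<close>, the set of examples that it mislabels.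

  Averaging the weights of the mechanism over the sample, instead of separating the sampling error
  from the error of the mechanism, gives the right dependency on \<open>\<beta>\<close>: for events of probability
  \<open>\<ge> r\<close> and \<open>\<le> r/8\<close>, \<open>exp (\<epsilon>/2 (hits g' - hits g))\<close> has expectation at most \<open>exp (- n \<epsilon> r / 4)\<close>.

  A good \<open>t\<close> of length \<open>k\<close> independent of \<open>d\<close> exists by the \<open>\<epsilon>\<close>-net theorem, proved by double
  sampling.
\<close>

section \<open>The Sauer--Shelah lemma\<close>

definition shattered_sets :: "'a set set \<Rightarrow> 'a set \<Rightarrow> 'a set set" where
  "shattered_sets F Y = {S. S \<subseteq> Y \<and> (\<forall>T\<subseteq>S. \<exists>A\<in>F. A \<inter> S = T)}"

lemma shattered_setsD: "S \<in> shattered_sets F Y \<Longrightarrow> T \<subseteq> S \<Longrightarrow> \<exists>A\<in>F. A \<inter> S = T"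
  by (simp add: shattered_sets_def)

lemma shattered_sets_subset: "S \<in> shattered_sets F Y \<Longrightarrow> S \<subseteq> Y"
  by (simp add: shattered_sets_def)

text \<open>Pajor's form of Sauer--Shelah, by induction on \<open>Y\<close>. Deleting
  \<open>y\<close> merges exactly the pairs \<open>A\<close>, \<open>insert y A\<close> with both
  members in \<open>F\<close>, so \<open>card F = card F0 + card F1\<close> for the restrictions
  \<open>F0\<close> and the merged pairs \<open>F1\<close>. Sets shattered by \<open>F0\<close> omit
  \<open>y\<close> and are shattered by \<open>F\<close>; sets shattered by \<open>F1\<close> remain
  shattered by \<open>F\<close> after adding \<open>y\<close>. The two kinds are disjoint.\<close>

lemma card_le_card_shattered_sets:
  assumes "finite Y" "F \<subseteq> Pow Y"
  shows "card F \<le> card (shattered_sets F Y)"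
  using assms
proof (induction Y arbitrary: F rule: finite_induct)
  case empty
  then have "F = {} \<or> F = {{}}" by auto
  moreover have "shattered_sets {{}} {} = {{} :: 'a set}" by (auto simp: shattered_sets_def)
  ultimately show ?case by (elim disjE) simp_all
next
  case (insert y Y)
  define F0 where "F0 = (\<lambda>A. A - {y}) ` F"
  define F1 where "F1 = {A. A \<subseteq> Y \<and> A \<in> F \<and> insert y A \<in> F}"
  have finF: "finite F" using insert.prems insert.hyps(1) by (meson finite.insertI finite_Pow_iff finite_subset)
  \<comment> \<open>\<open>F0\<close> and \<open>F1\<close> are the union and the intersection of
    \<open>Fa\<close> and \<open>Fb\<close>, which reduces the split to inclusion-exclusion.\<close>
  define Fa where "Fa = {A\<in>F. y \<notin> A}"
  define Fb where "Fb = (\<lambda>A. A - {y}) ` {A\<in>F. y \<in> A}"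
  have cb: "card Fb = card {A\<in>F. y \<in> A}"
    unfolding Fb_def by (rule card_image) (auto simp: inj_on_def)
  have F_split: "F = Fa \<union> {A\<in>F. y \<in> A}" by (auto simp: Fa_def)
  then have "card F = card Fa + card {A\<in>F. y \<in> A}"
    using finF by (metis (no_types, lifting) Collect_conj_eq card_Un_disjoint disjoint_iff
      Fa_def finite_Un mem_Collect_eq)
  also have "\<dots> = card (Fa \<union> Fb) + card (Fa \<inter> Fb)"
    unfolding cb[symmetric] by (rule card_Un_Int) (use finF in \<open>auto simp: Fa_def Fb_def\<close>)
  also have "Fa \<union> Fb = F0"
  proof -
    have "(\<lambda>A. A - {y}) ` Fa = id ` Fa" by (rule image_cong) (auto simp: Fa_def)
    then show ?thesis using arg_cong[OF F_split, of "image (\<lambda>A. A - {y})"]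
      unfolding F0_def Fb_def image_Un by simp
  qed
  also have "Fa \<inter> Fb = F1"
  proof
    show "Fa \<inter> Fb \<subseteq> F1" using insert.prems by (auto simp: Fa_def Fb_def F1_def insert_absorb)
    show "F1 \<subseteq> Fa \<inter> Fb"
    proof
      fix A assume A: "A \<in> F1"
      then have "y \<notin> A" using insert.hyps(2) by (auto simp: F1_def)
      then have "A = insert y A - {y}" by auto
      then show "A \<in> Fa \<inter> Fb" using A \<open>y \<notin> A\<close> by (auto simp: F1_def Fa_def Fb_def image_iff)
    qed
  qed
  finally have eq: "card F = card F0 + card F1" .
  have le0: "card F0 \<le> card (shattered_sets F0 Y)" using insert.prems by (intro insert.IH) (auto simp: F0_def)
  have le1: "card F1 \<le> card (shattered_sets F1 Y)" by (intro insert.IH) (auto simp: F1_def)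
  have fin: "finite (shattered_sets G Z)" if "finite Z" for G and Z :: "'a set"
    using that by (simp add: shattered_sets_def)
  have sub0: "shattered_sets F0 Y \<subseteq> shattered_sets F (insert y Y)"
  proof
    fix S assume S: "S \<in> shattered_sets F0 Y"
    have "\<exists>A\<in>F. A \<inter> S = T" if "T \<subseteq> S" for T
    proof -
      obtain A where "A \<in> F" "(A - {y}) \<inter> S = T"
        using shattered_setsD[OF S \<open>T \<subseteq> S\<close>] unfolding F0_def by blast
      moreover have "y \<notin> S" using shattered_sets_subset[OF S] insert.hyps(2) by blast
      ultimately show ?thesis by (intro bexI[of _ A]) auto
    qed
    then show "S \<in> shattered_sets F (insert y Y)"
      using shattered_sets_subset[OF S] unfolding shattered_sets_def by blast
  qed
  have sub1: "insert y ` shattered_sets F1 Y \<subseteq> shattered_sets F (insert y Y)"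
  proof safe
    fix S assume S: "S \<in> shattered_sets F1 Y"
    have "\<exists>A\<in>F. A \<inter> insert y S = T" if T: "T \<subseteq> insert y S" for T
    proof -
      have "T - {y} \<subseteq> S" using T by auto
      then obtain A where A: "A \<in> F1" "A \<inter> S = T - {y}" using shattered_setsD[OF S] by blast
      then have "y \<notin> A" using insert.hyps(2) by (auto simp: F1_def)
      show ?thesis
      proof (cases "y \<in> T")
        case True
        then have "insert y A \<inter> insert y S = T" using A by auto
        then show ?thesis using A by (intro bexI[of _ "insert y A"]) (auto simp: F1_def)
      next
        case False
        then have "A \<inter> insert y S = T" using A \<open>y \<notin> A\<close> by auto
        then show ?thesis using A by (intro bexI[of _ "A"]) (auto simp: F1_def)
      qed
    qed
    then show "insert y S \<in> shattered_sets F (insert y Y)"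
      using shattered_sets_subset[OF S] unfolding shattered_sets_def by blast
  qed
  have y_notin: "y \<notin> S" if "S \<in> shattered_sets G Y" for S G
    using shattered_sets_subset[OF that] insert.hyps(2) by blast
  have "inj_on (insert y) (shattered_sets F1 Y)"
    by (rule inj_onI) (metis y_notin insert_ident)
  then have "card (shattered_sets F0 Y) + card (shattered_sets F1 Y)
      = card (shattered_sets F0 Y) + card (insert y ` shattered_sets F1 Y)"
    by (simp add: card_image)
  also have "\<dots> = card (shattered_sets F0 Y \<union> insert y ` shattered_sets F1 Y)"
    using insert.hyps(1) y_notin[of _ F0]
    by (intro card_Un_disjoint[symmetric] fin finite_imageI) blast+
  also have "\<dots> \<le> card (shattered_sets F (insert y Y))"
    using sub0 sub1 insert.hyps by (intro card_mono fin) auto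
  finally show ?case using eq le0 le1 by linarith
qed

section \<open>Traces of a concept class and their representatives\<close>

definition traces :: "('x \<Rightarrow> bool) set \<Rightarrow> 'x set \<Rightarrow> 'x set set" where
  "traces C Y = (\<lambda>c. {x \<in> Y. c x}) ` C"

text \<open>Weighting with \<open>x ^ v \<le> x ^ i\<close> and completing the binomial sum gives
  \<open>(1 + x) ^ card Y\<close>. The usual bound is the case where \<open>x\<close> is
  \<open>v / card Y\<close>; leaving \<open>x\<close> free allows each use to tune it to its own
  sample size.\<close>

lemma card_bounded_subsets:
  assumes "finite Y" "0 < x" "x \<le> (1::real)"
  shows "real (card {S. S \<subseteq> Y \<and> card S \<le> v}) \<le> exp (x * card Y) / x ^ v"
proof -
  have "{S. S \<subseteq> Y \<and> card S \<le> v} = (\<Union>i\<in>{..v}. {S. S \<subseteq> Y \<and> card S = i})" by auto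
  also have "card \<dots> = (\<Sum>i\<le>v. card {S. S \<subseteq> Y \<and> card S = i})"
    using assms(1) by (intro card_UN_disjoint) auto
  also have "\<dots> = (\<Sum>i\<le>v. card Y choose i)" using assms(1) by (simp add: n_subsets)
  finally have "real (card {S. S \<subseteq> Y \<and> card S \<le> v}) * x ^ v = (\<Sum>i\<le>v. real (card Y choose i) * x ^ v)"
    by (simp add: sum_distrib_right)
  also have "\<dots> \<le> (\<Sum>i\<le>v. real (card Y choose i) * x ^ i)"
    using assms by (intro sum_mono mult_left_mono power_decreasing) auto
  \<comment> \<open>\<open>v\<close> may exceed \<open>card Y\<close>: the upper limit is raised to
    the maximum and then lowered, as the extra coefficients vanish.\<close>
  also have "\<dots> \<le> (\<Sum>i\<le>max v (card Y). real (card Y choose i) * x ^ i)"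
    using assms by (intro sum_mono2) auto
  also have "\<dots> = (\<Sum>i\<le>card Y. real (card Y choose i) * x ^ i)"
    by (intro sum.mono_neutral_right) auto
  also have "\<dots> = (1 + x) ^ card Y" using binomial_ring[of x 1 "card Y"] by (simp add: add.commute)
  also have "\<dots> \<le> exp x ^ card Y" using assms by (intro power_mono) auto
  also have "\<dots> = exp (x * card Y)" by (simp add: exp_of_nat2_mult)
  finally show ?thesis using assms by (simp add: field_simps)
qed

lemma shatters_card_le_vc_dim:
  assumes "finite X" "S \<subseteq> X" "shatters C S"
  shows "card S \<le> vc_dim X C"
  unfolding vc_dim_def
proof (rule Max_ge)
  have "{card S | S. S \<subseteq> X \<and> shatters C S} \<subseteq> card ` Pow X" by auto
  then show "finite {card S | S. S \<subseteq> X \<and> shatters C S}" using assms(1) by (meson finite_Pow_iff finite_imageI finite_subset)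
qed (use assms in auto)

text \<open>A set shattered by the traces on \<open>Y\<close> is shattered by \<open>C\<close>, so
  it has at most \<open>vc_dim X C\<close> elements; Pajor's inequality then bounds the traces by
  the number of such small subsets.\<close>

theorem card_traces_le:
  assumes "finite X" "Y \<subseteq> X" "0 < x" "x \<le> (1::real)"
  shows "real (card (traces C Y)) \<le> exp (x * card Y) / x ^ vc_dim X C"
proof -
  have fY: "finite Y" using assms finite_subset by auto
  have "card (traces C Y) \<le> card (shattered_sets (traces C Y) Y)"
    using fY by (intro card_le_card_shattered_sets) (auto simp: traces_def)
  also have "\<dots> \<le> card {S. S \<subseteq> Y \<and> card S \<le> vc_dim X C}"
  proof (rule card_mono)
    show "shattered_sets (traces C Y) Y \<subseteq> {S. S \<subseteq> Y \<and> card S \<le> vc_dim X C}"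
    proof safe
      fix S assume S: "S \<in> shattered_sets (traces C Y) Y"
      then have SY: "S \<subseteq> Y" by (auto simp: shattered_sets_def)
      then show "z \<in> Y" if "z \<in> S" for z using that by auto
      have "\<exists>c\<in>C. {x \<in> S. c x} = T" if "T \<subseteq> S" for T
      proof -
        obtain A where "A \<in> traces C Y" "A \<inter> S = T" using shattered_setsD[OF S \<open>T \<subseteq> S\<close>] by blast
        then obtain c where "c \<in> C" "{x \<in> Y. c x} \<inter> S = T" unfolding traces_def by blast
        then show ?thesis using SY by (intro bexI[of _ c]) auto
      qed
      then have "shatters C S" by (auto simp: shatters_def)
      then show "card S \<le> vc_dim X C" using SY assms by (intro shatters_card_le_vc_dim) auto
    qed
  qed (use fY in auto)
  finally have "real (card (traces C Y)) \<le> real (card {S. S \<subseteq> Y \<and> card S \<le> vc_dim X C})" by simp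
  also have "\<dots> \<le> exp (x * card Y) / x ^ vc_dim X C" using card_bounded_subsets[OF fY] assms by auto
  finally show ?thesis .
qed

text \<open>The choice depends on \<open>c\<close> only through its trace on \<open>Y\<close>, so
  concepts with equal traces share a representative and there are no more representatives than
  traces.\<close>

definition representative :: "('x \<Rightarrow> bool) set \<Rightarrow> 'x set \<Rightarrow> ('x \<Rightarrow> bool) \<Rightarrow> 'x \<Rightarrow> bool" where
  "representative C Y c = (SOME c'. c' \<in> C \<and> {x \<in> Y. c' x} = {x \<in> Y. c x})"

lemma representative:
  assumes "c \<in> C"
  shows "representative C Y c \<in> C" "x \<in> Y \<Longrightarrow> representative C Y c x = c x"
proof -
  have "representative C Y c \<in> C \<and> {x \<in> Y. representative C Y c x} = {x \<in> Y. c x}"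
    unfolding representative_def by (rule someI[of _ c]) (simp add: assms)
  then show "representative C Y c \<in> C" "x \<in> Y \<Longrightarrow> representative C Y c x = c x" by auto
qed

lemma card_representatives:
  assumes "finite Y"
  shows "finite (representative C Y ` C)" "card (representative C Y ` C) \<le> card (traces C Y)"
proof -
  have eq: "representative C Y ` C = (\<lambda>t. SOME c'. c' \<in> C \<and> {x \<in> Y. c' x} = t) ` traces C Y"
    by (auto simp: traces_def representative_def image_image)
  have "finite (traces C Y)" by (rule finite_subset[of _ "Pow Y"]) (use assms in \<open>auto simp: traces_def\<close>)
  then show "finite (representative C Y ` C)" "card (representative C Y ` C) \<le> card (traces C Y)"
    unfolding eq by (auto intro: card_image_le)
qed

lemma concept_class_card_traces:
  assumes "concept_class X C"
  shows "card (traces C X) = card C"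
  unfolding traces_def
proof (rule card_image, rule inj_onI)
  fix c c' assume cc: "c \<in> C" "c' \<in> C" "{x \<in> X. c x} = {x \<in> X. c' x}"
  then have "c \<in> X \<rightarrow>\<^sub>E UNIV" "c' \<in> X \<rightarrow>\<^sub>E UNIV" using assms by (auto simp: concept_class_def simp del: PiE_UNIV_domain)
  then show "c = c'" by (rule PiE_ext) (use cc(3) in blast)
qed

lemma finite_concept_class:
  assumes "concept_class X C" "finite X"
  shows "finite C"
  using assms(1) unfolding concept_class_def
  by (rule finite_subset) (rule finite_PiE, use assms(2) in simp_all)

lemma cube_conv_lists: "cube d = {xs. set xs \<subseteq> UNIV \<and> length xs = d}"
  by (auto simp: cube_def)

lemma finite_cube [simp]: "finite (cube d)"
  unfolding cube_conv_lists by (rule finite_lists_length_eq) simp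

lemma card_cube [simp]: "card (cube d) = 2 ^ d"
  unfolding cube_conv_lists by (subst card_lists_length_eq) auto

text \<open>Extensional concepts are determined by their traces on the whole cube, and
  \<open>x = 1 / 2 ^ d\<close> is the reciprocal of its size.\<close>

lemma card_concept_class_cube:
  assumes "concept_class (cube d) C"
  shows "real (card C) \<le> exp 1 * 2 ^ (d * vc_dim (cube d) C)"
  using card_traces_le[of "cube d" "cube d" "1 / 2 ^ d" C] concept_class_card_traces[OF assms]
  by (simp add: power_mult field_simps)

section \<open>Nets by double sampling\<close>

lemma expectation_mono_finite:
  fixes f g :: "'a \<Rightarrow> real"
  assumes "finite (set_pmf p)" "\<And>x. x \<in> set_pmf p \<Longrightarrow> f x \<le> g x"
  shows "measure_pmf.expectation p f \<le> measure_pmf.expectation p g"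
  by (intro integral_mono_AE integrable_measure_pmf_finite assms(1))
     (use assms(2) in \<open>auto simp: AE_measure_pmf_iff\<close>)

lemma expectation_cong_pmf:
  fixes f g :: "'a \<Rightarrow> real"
  assumes "\<And>x. x \<in> set_pmf p \<Longrightarrow> f x = g x"
  shows "measure_pmf.expectation p f = measure_pmf.expectation p g"
  by (intro integral_cong_AE) (use assms in \<open>auto simp: AE_measure_pmf_iff\<close>)

lemma expectation_le_const:
  fixes f :: "'a \<Rightarrow> real"
  assumes "finite (set_pmf p)" "\<And>x. x \<in> set_pmf p \<Longrightarrow> f x \<le> b"
  shows "measure_pmf.expectation p f \<le> b"
  using expectation_mono_finite[OF assms(1), of f "\<lambda>_. b"] assms(2) by simp

lemma expectation_bind_finite:
  fixes h :: "'b \<Rightarrow> real"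
  assumes "finite (set_pmf p)" "\<And>x. x \<in> set_pmf p \<Longrightarrow> finite (set_pmf (f x))"
  shows "measure_pmf.expectation (bind_pmf p f) h
    = measure_pmf.expectation p (\<lambda>x. measure_pmf.expectation (f x) h)"
  using pmf_expectation_bind[of "set_pmf p" f p h] assms
  by (simp add: integral_measure_pmf[of "set_pmf p"])

lemma finite_set_replicate_pmf:
  assumes "finite (set_pmf p)"
  shows "finite (set_pmf (replicate_pmf n p))"
proof -
  have "set_pmf (replicate_pmf n p) = {xs. set xs \<subseteq> set_pmf p \<and> length xs = n}"
    by (auto simp: set_replicate_pmf)
  then show ?thesis using finite_lists_length_eq[OF assms] by simp
qed

text \<open>Independence. Both sampling estimates below, for nets and for the exponential mechanism,
  are put into product form so that this applies.\<close>

lemma expectation_replicate_prod_list: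
  fixes f :: "'a \<Rightarrow> real"
  assumes "finite (set_pmf p)"
  shows "measure_pmf.expectation (replicate_pmf n p) (\<lambda>xs. prod_list (map f xs))
    = measure_pmf.expectation p f ^ n"
proof (induction n)
  case (Suc n)
  have "replicate_pmf (Suc n) p = bind_pmf p (\<lambda>x. map_pmf ((#) x) (replicate_pmf n p))"
    by (simp add: map_pmf_def)
  then show ?case
    using assms finite_set_replicate_pmf[OF assms, of n] Suc
    by (simp add: expectation_bind_finite mult.commute del: replicate_pmf.simps)
qed simp

primrec resample :: "('a \<Rightarrow> 'b pmf) \<Rightarrow> 'a list \<Rightarrow> 'b list pmf" where
  "resample K [] = return_pmf []"
| "resample K (z # zs) = bind_pmf (K z) (\<lambda>z'. map_pmf ((#) z') (resample K zs))"

text \<open>Redrawing entries independently commutes with i.i.d. sampling. In particular, a kernel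
  that preserves \<open>p\<close> preserves the distribution of the sample.\<close>

lemma bind_replicate_resample:
  "bind_pmf (replicate_pmf n p) (resample K) = replicate_pmf n (bind_pmf p K)"
proof (induction n)
  case 0
  then show ?case by (simp add: bind_return_pmf)
next
  case (Suc n)
  have "bind_pmf (replicate_pmf (Suc n) p) (resample K) =
    bind_pmf p (\<lambda>x. bind_pmf (replicate_pmf n p) (\<lambda>xs. bind_pmf (K x) (\<lambda>z'. map_pmf ((#) z') (resample K xs))))"
    by (simp add: bind_assoc_pmf bind_return_pmf)
  also have "\<dots> = bind_pmf p (\<lambda>x. bind_pmf (K x) (\<lambda>z'. bind_pmf (replicate_pmf n p) (\<lambda>xs. map_pmf ((#) z') (resample K xs))))"
    by (subst bind_commute_pmf) (rule refl)
  also have "\<dots> = bind_pmf p (\<lambda>x. bind_pmf (K x) (\<lambda>z'. map_pmf ((#) z') (bind_pmf (replicate_pmf n p) (resample K))))"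
    by (simp add: map_bind_pmf)
  also have "\<dots> = replicate_pmf (Suc n) (bind_pmf p K)"
    unfolding Suc by (simp add: bind_assoc_pmf map_pmf_def)
  finally show ?case .
qed

lemma finite_set_resample:
  assumes "\<And>z. z \<in> set zs \<Longrightarrow> finite (set_pmf (K z))"
  shows "finite (set_pmf (resample K zs))"
  using assms by (induction zs) auto

lemma expectation_resample_prod_list:
  fixes f :: "'b \<Rightarrow> real"
  assumes "\<And>z. z \<in> set zs \<Longrightarrow> finite (set_pmf (K z))"
  shows "measure_pmf.expectation (resample K zs) (\<lambda>ys. prod_list (map f ys))
    = prod_list (map (\<lambda>z. measure_pmf.expectation (K z) f) zs)"
  using assms
proof (induction zs)
  case (Cons z zs)
  have "finite (set_pmf (resample K zs))" using Cons.prems by (intro finite_set_resample) auto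
  then show ?case using Cons by (simp add: expectation_bind_finite mult.commute)
qed simp

text \<open>Allows the second half of a double sample to be averaged while the first half is held
  fixed.\<close>

lemma replicate_pair_pmf:
  "replicate_pmf n (pair_pmf p q)
    = bind_pmf (replicate_pmf n p) (\<lambda>xs. map_pmf (zip xs) (replicate_pmf n q))"
proof (induction n)
  case 0
  then show ?case by (simp add: bind_return_pmf)
next
  case (Suc n)
  have "replicate_pmf (Suc n) (pair_pmf p q) = bind_pmf p (\<lambda>x. bind_pmf q (\<lambda>y.
      bind_pmf (replicate_pmf n p) (\<lambda>xs. bind_pmf (replicate_pmf n q) (\<lambda>ys. return_pmf ((x, y) # zip xs ys)))))"
    using Suc by (simp add: pair_pmf_def bind_assoc_pmf bind_return_pmf map_pmf_def)
  also have "\<dots> = bind_pmf p (\<lambda>x. bind_pmf (replicate_pmf n p) (\<lambda>xs. bind_pmf q (\<lambda>y.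
      bind_pmf (replicate_pmf n q) (\<lambda>ys. return_pmf ((x, y) # zip xs ys)))))"
    by (subst bind_commute_pmf) (rule refl)
  also have "\<dots> = bind_pmf (replicate_pmf (Suc n) p) (\<lambda>xs. map_pmf (zip xs) (replicate_pmf (Suc n) q))"
    by (simp add: bind_assoc_pmf bind_return_pmf map_pmf_def)
  finally show ?case .
qed

section \<open>Random swaps of a double sample\<close>

definition coin_swap :: "'a \<times> 'a \<Rightarrow> ('a \<times> 'a) pmf" where
  "coin_swap z = map_pmf (\<lambda>b. if b then z else prod.swap z) (bernoulli_pmf (1/2))"

lemma set_coin_swap: "set_pmf (coin_swap z) = {z, prod.swap z}"
  by (auto simp: coin_swap_def)

text \<open>Two independent draws from \<open>p\<close> are exchangeable, so neither outcome of the
  coin changes their joint distribution.\<close>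

lemma bind_pair_coin_swap: "bind_pmf (pair_pmf p p) coin_swap = pair_pmf p p"
proof -
  have "bind_pmf (pair_pmf p p) coin_swap
      = bind_pmf (bernoulli_pmf (1/2)) (\<lambda>b. map_pmf (\<lambda>z. if b then z else prod.swap z) (pair_pmf p p))"
    unfolding coin_swap_def map_pmf_def by (subst bind_commute_pmf) (rule refl)
  also have "(\<lambda>b. map_pmf (\<lambda>z. if b then z else prod.swap z) (pair_pmf p p)) = (\<lambda>b. pair_pmf p p)"
  proof
    fix b
    have "map_pmf prod.swap (pair_pmf p p) = pair_pmf p p"
      by (subst (2) pair_commute_pmf) (auto intro: map_pmf_cong)
    then show "map_pmf (\<lambda>z. if b then z else prod.swap z) (pair_pmf p p) = pair_pmf p p"
      by (cases b) (simp_all add: map_pmf_ident[unfolded id_def])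
  qed
  finally show ?thesis by simp
qed

definition points :: "('a \<times> 'a) list \<Rightarrow> 'a set" where
  "points zs = fst ` set zs \<union> snd ` set zs"

text \<open>Keeps the set of representatives fixed while averaging over the swaps.\<close>

lemma resample_coin_swap_points:
  "zs' \<in> set_pmf (resample coin_swap zs) \<Longrightarrow> points zs' = points zs"
proof (induction zs arbitrary: zs')
  case (Cons z zs)
  then obtain z' ys where "zs' = z' # ys" "ys \<in> set_pmf (resample coin_swap zs)" "z' = z \<or> z' = prod.swap z"
    by (cases z) (auto simp: set_coin_swap)
  then show ?case using Cons.IH[of ys] by (auto simp: points_def)
qed (simp add: points_def)

lemma card_points_le: "card (points zs) \<le> 2 * length zs"
proof -
  have "card (points zs) \<le> card (fst ` set zs) + card (snd ` set zs)"
    unfolding points_def by (rule card_Un_le)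
  also have "\<dots> \<le> card (set zs) + card (set zs)" by (intro add_mono card_image_le) auto
  also have "\<dots> \<le> 2 * length zs" using card_length[of zs] by simp
  finally show ?thesis .
qed

text \<open>
  If \<open>g\<close> misses all first components, the product of the weights over the pairs is \<open>2\<close> to the number of
  second components in \<open>g\<close>, which on average grows like \<open>(1 + s)^k\<close> when \<open>g\<close> has probability \<open>s\<close>.
  Swapping every pair by a fair coin makes each factor at most \<open>1\<close> on average, and does not change
  the number of traces.
\<close>

definition miss_weight :: "('a \<Rightarrow> bool) \<times> ('a \<Rightarrow> bool) \<Rightarrow> 'a \<times> 'a \<Rightarrow> real" where
  "miss_weight cc z = (if fst cc (fst z) \<noteq> snd cc (fst z) then 0
     else if fst cc (snd z) \<noteq> snd cc (snd z) then 2 else 1)"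

text \<open>If the two concepts differ on exactly one component of \<open>z\<close>, the two orders
  weigh 0 and 2, with average 1; if on both, the weight is 0; if on neither, it is 1.\<close>

lemma expectation_coin_swap_miss_weight:
  "measure_pmf.expectation (coin_swap z) (miss_weight cc) \<le> 1"
  by (auto simp: coin_swap_def miss_weight_def)

lemma prod_list_le_1:
  fixes xs :: "real list"
  assumes "\<And>x. x \<in> set xs \<Longrightarrow> 0 \<le> x \<and> x \<le> 1"
  shows "prod_list xs \<le> 1"
  using assms
proof (induction xs)
  case (Cons x xs)
  then have "x * prod_list xs \<le> 1 * 1" by (intro mult_mono prod_list_nonneg) auto
  then show ?case by simp
qed simp

lemma miss_weight_nonneg [simp]: "0 \<le> miss_weight cc z"
  by (simp add: miss_weight_def)

text \<open>Otherwise every sample \<open>xs\<close> of length \<open>k\<close> has a pair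
  \<open>g xs\<close> in \<open>C\<close> that agrees on \<open>xs\<close> but differs with
  probability above \<open>s\<close>. The sum \<open>F\<close> of weight products then has
  expectation at least \<open>(1 + s) ^ k\<close>, from the pair given by the first half alone, and
  at most \<open>N\<^sup>2\<close>, by averaging over swaps. \<open>N\<close> only has to bound
  traces on the at most \<open>2 * k\<close> points of both halves.\<close>

theorem exists_net:
  assumes X: "finite X" "set_pmf p \<subseteq> X"
    and N: "\<And>Y. Y \<subseteq> X \<Longrightarrow> card Y \<le> 2 * k \<Longrightarrow> real (card (traces C Y)) \<le> N"
    and "N\<^sup>2 < (1 + s) ^ k" "0 \<le> s"
  shows "\<exists>xs. length xs = k \<and> set xs \<subseteq> X \<and> (\<forall>c\<in>C. \<forall>c'\<in>C. (\<forall>x\<in>set xs. c x = c' x)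
    \<longrightarrow> measure_pmf.prob p {x. c x \<noteq> c' x} \<le> s)"
proof (rule ccontr)
  assume no_net: "\<not> ?thesis"
  define P where "P xs cc \<longleftrightarrow> cc \<in> C \<times> C \<and> (\<forall>x\<in>set xs. fst cc x = snd cc x)
      \<and> s < measure_pmf.prob p {x. fst cc x \<noteq> snd cc x}" for xs cc
  have ex: "\<exists>cc. P xs cc" if "length xs = k" "set xs \<subseteq> X" for xs
  proof -
    have "\<not> (\<forall>c\<in>C. \<forall>c'\<in>C. (\<forall>x\<in>set xs. c x = c' x)
        \<longrightarrow> measure_pmf.prob p {x. c x \<noteq> c' x} \<le> s)"
      using no_net that by blast
    then obtain c c' where "c \<in> C" "c' \<in> C" "\<forall>x\<in>set xs. c x = c' x"
        "s < measure_pmf.prob p {x. c x \<noteq> c' x}"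
      unfolding not_le[symmetric] by blast
    then show ?thesis by (intro exI[of _ "(c, c')"]) (simp add: P_def)
  qed
  define g where "g xs = (SOME cc. P xs cc)" for xs
  have g: "g xs \<in> C \<times> C" "\<And>x. x \<in> set xs \<Longrightarrow> fst (g xs) x = snd (g xs) x"
      "s < measure_pmf.prob p {x. fst (g xs) x \<noteq> snd (g xs) x}"
    if "length xs = k" "set xs \<subseteq> X" for xs
  proof -
    have "P xs (g xs)" unfolding g_def by (rule someI_ex[OF ex[OF that]])
    then show "g xs \<in> C \<times> C" "\<And>x. x \<in> set xs \<Longrightarrow> fst (g xs) x = snd (g xs) x"
      "s < measure_pmf.prob p {x. fst (g xs) x \<noteq> snd (g xs) x}"
      unfolding P_def by blast+
  qed
  have finp: "finite (set_pmf p)" using X finite_subset by auto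
  define Q where "Q = replicate_pmf k (pair_pmf p p)"
  define R where "R zs = representative C (points zs) ` C" for zs
  \<comment> \<open>The pair chosen by \<open>g\<close> depends on the first half and changes under
    swaps. The sum over all pairs of representatives dominates its term, and its index set is
    invariant under swaps.\<close>
  define F where "F zs = (\<Sum>cc \<in> R zs \<times> R zs. prod_list (map (miss_weight cc) zs))" for zs
  have finQ: "finite (set_pmf Q)" unfolding Q_def by (intro finite_set_replicate_pmf) (simp add: finp)
  have Qprops: "length zs = k" "points zs \<subseteq> X" if "zs \<in> set_pmf Q" for zs
    using that X by (auto simp: Q_def set_replicate_pmf points_def)
  have finR: "finite (R zs)" for zs
    unfolding R_def by (rule card_representatives) (simp add: points_def)
  have fin_swap: "finite (set_pmf (coin_swap z))" for z :: "'a \<times> 'a" by (simp add: coin_swap_def)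
  have "measure_pmf.expectation Q F = measure_pmf.expectation (bind_pmf Q (resample coin_swap)) F"
    by (simp add: Q_def bind_replicate_resample bind_pair_coin_swap)
  also have "\<dots> = measure_pmf.expectation Q (\<lambda>zs. measure_pmf.expectation (resample coin_swap zs) F)"
    by (intro expectation_bind_finite finQ finite_set_resample fin_swap)
  also have "\<dots> \<le> N\<^sup>2"
  proof (rule expectation_le_const[OF finQ])
    fix zs assume zs: "zs \<in> set_pmf Q"
    have "measure_pmf.expectation (resample coin_swap zs) F = measure_pmf.expectation (resample coin_swap zs)
        (\<lambda>zs'. \<Sum>cc \<in> R zs \<times> R zs. prod_list (map (miss_weight cc) zs'))"
      by (rule expectation_cong_pmf) (simp add: F_def R_def resample_coin_swap_points)
    also have "\<dots> = (\<Sum>cc \<in> R zs \<times> R zs. measure_pmf.expectation (resample coin_swap zs)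
        (\<lambda>zs'. prod_list (map (miss_weight cc) zs')))"
      by (intro Bochner_Integration.integral_sum integrable_measure_pmf_finite finite_set_resample fin_swap)
    also have "\<dots> \<le> (\<Sum>cc \<in> R zs \<times> R zs. 1)"
    proof (rule sum_mono)
      fix cc
      have "measure_pmf.expectation (resample coin_swap zs) (\<lambda>zs'. prod_list (map (miss_weight cc) zs'))
          = prod_list (map (\<lambda>z. measure_pmf.expectation (coin_swap z) (miss_weight cc)) zs)"
        by (intro expectation_resample_prod_list fin_swap)
      also have "\<dots> \<le> 1"
        by (rule prod_list_le_1) (auto intro!: expectation_coin_swap_miss_weight integral_nonneg)
      finally show "measure_pmf.expectation (resample coin_swap zs) (\<lambda>zs'. prod_list (map (miss_weight cc) zs')) \<le> 1" .
    qed
    also have "\<dots> = (real (card (R zs)))\<^sup>2" by (simp add: card_cartesian_product power2_eq_square)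
    also have "\<dots> \<le> N\<^sup>2"
    proof (rule power_mono)
      have "card (R zs) \<le> card (traces C (points zs))"
        unfolding R_def by (rule card_representatives) (simp add: points_def)
      also have "real (card (traces C (points zs))) \<le> N"
        using Qprops[OF zs] card_points_le[of zs] by (intro N) auto
      finally show "real (card (R zs)) \<le> N" by simp
    qed simp
    finally show "measure_pmf.expectation (resample coin_swap zs) F \<le> N\<^sup>2" .
  qed
  finally have upper: "measure_pmf.expectation Q F \<le> N\<^sup>2" .

  have "(1 + s) ^ k \<le> measure_pmf.expectation Q (\<lambda>zs. prod_list (map (miss_weight (g (map fst zs))) zs))"
  proof -
    have finr: "finite (set_pmf (replicate_pmf k p))" by (intro finite_set_replicate_pmf finp)
    have "measure_pmf.expectation Q (\<lambda>zs. prod_list (map (miss_weight (g (map fst zs))) zs))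
      = measure_pmf.expectation (replicate_pmf k p) (\<lambda>xs. measure_pmf.expectation (replicate_pmf k p)
          (\<lambda>ys. prod_list (map (miss_weight (g (map fst (zip xs ys)))) (zip xs ys))))"
      unfolding Q_def replicate_pair_pmf
      by (subst expectation_bind_finite) (auto simp: finr)
    also have "\<dots> \<ge> measure_pmf.expectation (replicate_pmf k p) (\<lambda>_. (1 + s) ^ k)"
    proof (rule expectation_mono_finite[OF finr])
      fix xs assume "xs \<in> set_pmf (replicate_pmf k p)"
      then have xs: "length xs = k" "set xs \<subseteq> X" using X by (auto simp: set_replicate_pmf)
      define h where "h x \<longleftrightarrow> fst (g xs) x \<noteq> snd (g xs) x" for x
      have "measure_pmf.expectation (replicate_pmf k p)
          (\<lambda>ys. prod_list (map (miss_weight (g (map fst (zip xs ys)))) (zip xs ys)))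
        = measure_pmf.expectation (replicate_pmf k p) (\<lambda>ys. prod_list (map (\<lambda>y. 1 + indicator {x. h x} y) ys))"
      proof (rule expectation_cong_pmf)
        fix ys assume "ys \<in> set_pmf (replicate_pmf k p)"
        then have ys: "length ys = length xs" using xs by (auto simp: set_replicate_pmf)
        \<comment> \<open>The pair agrees on all of \<open>xs\<close>, so weight 0 never occurs and
          only the second component matters.\<close>
        have "map (miss_weight (g xs)) (zip xs ys) = map (\<lambda>z. 1 + indicator {x. h x} (snd z)) (zip xs ys)"
          using g[OF xs] by (auto simp: miss_weight_def h_def dest!: set_zip_leftD)
        also have "\<dots> = map (\<lambda>y. 1 + indicator {x. h x} y) (map snd (zip xs ys))" by simp
        finally show "prod_list (map (miss_weight (g (map fst (zip xs ys)))) (zip xs ys))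
            = prod_list (map (\<lambda>y. 1 + indicator {x. h x} y) ys)"
          using ys by simp
      qed
      also have "\<dots> = measure_pmf.expectation p (\<lambda>y. 1 + indicator {x. h x} y) ^ k"
        by (rule expectation_replicate_prod_list[OF finp])
      also have "measure_pmf.expectation p (\<lambda>y. 1 + indicator {x. h x} y :: real) = 1 + measure_pmf.prob p {x. h x}"
        by (subst Bochner_Integration.integral_add) (auto intro!: integrable_measure_pmf_finite finp)
      also have "(1 + measure_pmf.prob p {x. h x}) ^ k \<ge> (1 + s) ^ k"
        using g[OF xs] \<open>0 \<le> s\<close> by (intro power_mono) (auto simp: h_def)
      finally show "(1 + s) ^ k \<le> measure_pmf.expectation (replicate_pmf k p)
          (\<lambda>ys. prod_list (map (miss_weight (g (map fst (zip xs ys)))) (zip xs ys)))" .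
    qed
    finally show ?thesis by simp
  qed
  also have "\<dots> \<le> measure_pmf.expectation Q F"
  proof (rule expectation_mono_finite[OF finQ])
    fix zs assume zs: "zs \<in> set_pmf Q"
    have "points zs \<subseteq> X" "length zs = k" using Qprops[OF zs] by auto
    then have "g (map fst zs) \<in> C \<times> C" using g(1)[of "map fst zs"] by (auto simp: points_def)
    then obtain a b where ab: "g (map fst zs) = (a, b)" "a \<in> C" "b \<in> C" by blast
    \<comment> \<open>Representatives on all points of \<open>zs\<close> give the same weights, so
      the product is one of the terms of \<open>F zs\<close>.\<close>
    define r where "r = (representative C (points zs) a, representative C (points zs) b)"
    have "map (miss_weight (a, b)) zs = map (miss_weight r) zs"
    proof (rule map_cong[OF refl])
      fix z assume "z \<in> set zs"
      then have "fst z \<in> points zs" "snd z \<in> points zs" by (auto simp: points_def)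
      then show "miss_weight (a, b) z = miss_weight r z"
        using representative(2)[OF ab(2)] representative(2)[OF ab(3)] by (simp add: miss_weight_def r_def)
    qed
    moreover have "r \<in> R zs \<times> R zs" using ab by (simp add: r_def R_def)
    ultimately show "prod_list (map (miss_weight (g (map fst zs))) zs) \<le> F zs"
      unfolding F_def ab(1) using finR
      by (simp only:) (rule member_le_sum, auto intro!: prod_list_nonneg)
  qed
  finally show False using upper assms(4) by linarith
qed

section \<open>The exponential mechanism\<close>

definition exp_mech :: "'o set \<Rightarrow> ('o \<Rightarrow> real) \<Rightarrow> 'o pmf" where
  "exp_mech A w = embed_pmf (\<lambda>x. if x \<in> A then w x / sum w A else 0)"

lemma pmf_exp_mech:
  assumes "finite A" "A \<noteq> {}" "\<And>x. x \<in> A \<Longrightarrow> 0 < w x"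
  shows "pmf (exp_mech A w) x = (if x \<in> A then w x / sum w A else 0)"
  unfolding exp_mech_def
proof (rule pmf_embed_pmf)
  have S: "0 < sum w A" using assms by (intro sum_pos) auto
  then show nonneg: "0 \<le> (if x \<in> A then w x / sum w A else 0)" for x
    using assms(3)[of x] by (cases "x \<in> A") (simp_all add: less_imp_le)
  have "(\<integral>\<^sup>+x. ennreal (if x \<in> A then w x / sum w A else 0) \<partial>count_space UNIV)
      = (\<Sum>x\<in>A. ennreal (if x \<in> A then w x / sum w A else 0))"
    using assms(1) by (intro nn_integral_count_space'[OF assms(1)]) auto
  also have "\<dots> = ennreal (\<Sum>x\<in>A. if x \<in> A then w x / sum w A else 0)"
    by (intro sum_ennreal nonneg)
  also have "(\<Sum>x\<in>A. if x \<in> A then w x / sum w A else 0) = 1"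
    using S by (simp add: sum_divide_distrib[symmetric])
  finally show "(\<integral>\<^sup>+x. ennreal (if x \<in> A then w x / sum w A else 0) \<partial>count_space UNIV) = 1" by simp
qed

lemma set_exp_mech:
  assumes "finite A" "A \<noteq> {}" "\<And>x. x \<in> A \<Longrightarrow> 0 < w x"
  shows "set_pmf (exp_mech A w) \<subseteq> A"
  using pmf_exp_mech[OF assms] by (auto simp: set_pmf_eq split: if_splits)

text \<open>The normalizing sum is at least the weight of any single competitor \<open>y\<close>.
  This leaves a ratio of two weights, which can be averaged over the sample.\<close>

lemma pmf_exp_mech_le:
  assumes A: "finite A" "A \<noteq> {}" "\<And>x. x \<in> A \<Longrightarrow> 0 < w x" and "y \<in> A" "x \<in> A"
  shows "pmf (exp_mech A w) x \<le> w x / w y"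
proof -
  have "w y \<le> sum w A" using assms by (intro member_le_sum) (auto intro: less_imp_le)
  moreover have "pmf (exp_mech A w) x = w x / sum w A" using pmf_exp_mech[of A w x] assms by simp
  ultimately show ?thesis using assms(3)[of x] assms(3)[of y] assms(4,5) by (simp add: frac_le)
qed

text \<open>One factor \<open>b\<close> comes from the weight of \<open>x\<close> and one from the
  normalizing sum.\<close>

lemma pmf_exp_mech_ratio:
  assumes A: "finite A" "A \<noteq> {}" "\<And>x. x \<in> A \<Longrightarrow> 0 < w x" "\<And>x. x \<in> A \<Longrightarrow> 0 < w' x"
    and b: "0 < b" "\<And>x. x \<in> A \<Longrightarrow> w x \<le> b * w' x" "\<And>x. x \<in> A \<Longrightarrow> w' x \<le> b * w x"
  shows "pmf (exp_mech A w) x \<le> b\<^sup>2 * pmf (exp_mech A w') x"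
proof (cases "x \<in> A")
  case True
  have S: "0 < sum w A" "0 < sum w' A" using A by (auto intro!: sum_pos)
  have "sum w' A \<le> b * sum w A" unfolding sum_distrib_left by (intro sum_mono b)
  then have "w x * sum w' A \<le> (b * w' x) * (b * sum w A)"
    using b True S A by (intro mult_mono) (auto intro: less_imp_le)
  then have "w x / sum w A \<le> b\<^sup>2 * (w' x / sum w' A)"
    using S by (simp add: field_simps power2_eq_square)
  then show ?thesis using True pmf_exp_mech[of A w] pmf_exp_mech[of A w'] A by simp
qed (use pmf_exp_mech[of A w] pmf_exp_mech[of A w'] A in simp)

text \<open>
  Unlike \<^const>\<open>neighboring\<close>, this allows equal lists, and is thus preserved when labels are erased.
\<close>

definition near :: "'a list \<Rightarrow> 'a list \<Rightarrow> bool" where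
  "near xs ys \<longleftrightarrow> length xs = length ys \<and> (\<exists>i. \<forall>j<length xs. j \<noteq> i \<longrightarrow> xs ! j = ys ! j)"

lemma nearE:
  assumes "near xs ys"
  obtains i where "\<forall>j<length xs. j \<noteq> i \<longrightarrow> xs ! j = ys ! j" "length xs = length ys"
  using assms unfolding near_def by blast

lemma near_sym: "near xs ys \<Longrightarrow> near ys xs"
  unfolding near_def by metis

lemma near_map: "near xs ys \<Longrightarrow> near (map f xs) (map f ys)"
  unfolding near_def by (metis length_map nth_map)

lemma neighboring_imp_near:
  assumes "neighboring xs ys"
  shows "near xs ys"
proof -
  obtain i where "{j. j < length xs \<and> xs ! j \<noteq> ys ! j} = {i}"
    using assms unfolding neighboring_def by (auto elim: card_1_singletonE simp del: One_nat_def)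
  then show ?thesis using assms unfolding near_def neighboring_def by blast
qed

text \<open>The one index that may differ lies on one side of the cut at \<open>m\<close>, so only
  one of the two stages sees a change.\<close>

lemma near_cases:
  assumes "near xs ys"
  obtains "take m xs = take m ys" "near (drop m xs) (drop m ys)"
  | "near (take m xs) (take m ys)" "drop m xs = drop m ys"
proof -
  obtain i where i: "\<forall>j<length xs. j \<noteq> i \<longrightarrow> xs ! j = ys ! j" and len: "length xs = length ys"
    using assms by (rule nearE)
  show thesis
  proof (cases "i < m")
    case True
    have "drop m xs = drop m ys" using True i len by (intro nth_equalityI) auto
    moreover have "near (take m xs) (take m ys)" unfolding near_def using i len
      by (intro conjI exI[of _ i]) auto
    ultimately show ?thesis using that by blast
  next
    case False
    have "take m xs = take m ys" using False i len by (intro nth_equalityI) auto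
    moreover have "near (drop m xs) (drop m ys)" unfolding near_def using i len
      by (intro conjI exI[of _ "i - m"]) auto
    ultimately show ?thesis using that by blast
  qed
qed

section \<open>Scores and private selection\<close>

definition hits :: "('a \<Rightarrow> bool) \<Rightarrow> 'a list \<Rightarrow> nat" where
  "hits g xs = length (filter g xs)"

text \<open>Meant for finite nonempty \<open>G\<close>. A maximum, unlike a sum of counts, changes
  by at most 1 between near samples whatever the size of \<open>G\<close>.\<close>

definition score :: "('a \<Rightarrow> bool) set \<Rightarrow> 'a list \<Rightarrow> nat" where
  "score G xs = Max ((\<lambda>g. hits g xs) ` G)"

lemma hits_near:
  assumes "near xs ys"
  shows "hits g xs \<le> hits g ys + 1"
proof -
  obtain i where i: "\<forall>j<length xs. j \<noteq> i \<longrightarrow> xs ! j = ys ! j" and len: "length xs = length ys"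
    using assms by (rule nearE)
  have "card {j. j < length xs \<and> g (xs ! j)} \<le> card (insert i {j. j < length ys \<and> g (ys ! j)})"
    using i len by (intro card_mono) auto
  also have "\<dots> \<le> card {j. j < length ys \<and> g (ys ! j)} + 1" by (simp add: card_insert_if)
  finally show ?thesis by (simp add: hits_def length_filter_conv_card)
qed

lemma score_near:
  assumes "near xs ys" "finite G" "G \<noteq> {}"
  shows "score G xs \<le> score G ys + 1"
  unfolding score_def
proof (rule Max.boundedI)
  fix a assume "a \<in> (\<lambda>g. hits g xs) ` G"
  then obtain g where "g \<in> G" "a = hits g xs" by auto
  moreover have "hits g ys \<le> Max ((\<lambda>g. hits g ys) ` G)" using assms \<open>g \<in> G\<close> by auto
  ultimately show "a \<le> Max ((\<lambda>g. hits g ys) ` G) + 1" using hits_near[OF assms(1), of g] by linarith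
qed (use assms in auto)

text \<open>Low scores are favored. The exponent carries \<open>\<epsilon> / 2\<close> because the
  weight and the normalizing sum each lose a factor \<open>exp (\<epsilon> / 2)\<close> between near
  samples.\<close>

definition select :: "real \<Rightarrow> 'o set \<Rightarrow> ('o \<Rightarrow> ('a \<Rightarrow> bool) set) \<Rightarrow> 'a list \<Rightarrow> 'o pmf" where
  "select \<epsilon> A G xs = exp_mech A (\<lambda>x. exp (- (\<epsilon> / 2) * real (score (G x) xs)))"

lemma set_select: "finite A \<Longrightarrow> A \<noteq> {} \<Longrightarrow> set_pmf (select \<epsilon> A G xs) \<subseteq> A"
  unfolding select_def by (rule set_exp_mech) auto

lemma select_private:
  assumes "finite A" "A \<noteq> {}" "\<And>x. x \<in> A \<Longrightarrow> finite (G x) \<and> G x \<noteq> {}" "0 < \<epsilon>" "near xs ys"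
  shows "pmf (select \<epsilon> A G xs) x \<le> exp \<epsilon> * pmf (select \<epsilon> A G ys) x"
proof -
  have *: "exp (- (\<epsilon> / 2) * real (score (G x) us)) \<le> exp (\<epsilon> / 2) * exp (- (\<epsilon> / 2) * real (score (G x) vs))"
    if "near vs us" "x \<in> A" for us vs x
  proof -
    have "real (score (G x) vs) \<le> real (score (G x) us) + 1"
      using score_near[OF that(1), of "G x"] assms(3)[OF that(2)] by simp
    then have "\<epsilon> / 2 * real (score (G x) vs) \<le> \<epsilon> / 2 * (real (score (G x) us) + 1)"
      using assms(4) by (intro mult_left_mono) auto
    then show ?thesis unfolding exp_add[symmetric] by (simp add: algebra_simps)
  qed
  have "pmf (select \<epsilon> A G xs) x \<le> (exp (\<epsilon> / 2))\<^sup>2 * pmf (select \<epsilon> A G ys) x"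
    unfolding select_def using assms(1,2) by (rule pmf_exp_mech_ratio) (auto simp only: exp_gt_zero intro!: * assms(5) near_sym[OF assms(5)])
  also have "(exp (\<epsilon> / 2))\<^sup>2 = exp \<epsilon>" by (simp add: power2_eq_square exp_add[symmetric])
  finally show ?thesis .
qed

section \<open>Accuracy of selection by averaging over the sample\<close>

lemma exp_hits_diff:
  fixes h :: real
  shows "exp (h * (real (hits g' xs) - real (hits g xs)))
    = prod_list (map (\<lambda>x. exp (h * (of_bool (g' x) - of_bool (g x)))) xs)"
proof (induction xs)
  case (Cons x xs)
  have "h * (real (hits g' (x # xs)) - real (hits g (x # xs)))
      = h * (of_bool (g' x) - of_bool (g x)) + h * (real (hits g' xs) - real (hits g xs))"
    by (simp add: hits_def algebra_simps)
  then show ?case by (simp only: exp_add list.map prod_list.Cons Cons)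
qed (simp add: hits_def)

lemma exp_minus_le_linear:
  fixes h :: real
  assumes "0 \<le> h" "h \<le> 1 / 2"
  shows "exp (- h) \<le> 1 - 3 * h / 4"
proof -
  have hh: "h * h \<le> 1 / 4" using mult_mono[OF assms(2,2)] assms by simp
  \<comment> \<open>The quantity is the excess over 1 of the product in the next line, whose second
    factor is the quadratic Taylor bound for \<open>exp h\<close>.\<close>
  have "0 \<le> h * (1 / 4 - h / 4 - 3 / 8 * (h * h))" using assms hh by (intro mult_nonneg_nonneg) linarith+
  then have "1 \<le> (1 - 3 * h / 4) * (1 + h + h\<^sup>2 / 2)" by (simp add: algebra_simps power2_eq_square)
  also have "\<dots> \<le> (1 - 3 * h / 4) * exp h"
    using assms exp_lower_Taylor_quadratic[of h] by (intro mult_left_mono) auto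
  finally show ?thesis by (simp add: exp_minus field_simps)
qed

text \<open>By independence this is the \<open>n\<close>-th power of the expectation for one entry.
  With \<open>h = \<epsilon> / 2\<close>, an entry in \<open>g'\<close> gains at most
  \<open>2 * h\<close>, with probability at most \<open>r / 8\<close>; an entry in \<open>g\<close>
  loses at least \<open>3 * h / 4\<close>, with probability at least \<open>r\<close>. The sum is
  \<open>1 + h * r / 4 - 3 * h * r / 4 = 1 - \<epsilon> * r / 4\<close>.\<close>

lemma expectation_exp_hits_diff:
  assumes p: "finite (set_pmf p)" and eps: "0 < \<epsilon>" "\<epsilon> \<le> 1" and "0 \<le> r"
    and g: "r \<le> measure_pmf.prob p {x. g x}" "measure_pmf.prob p {x. g' x} \<le> r / 8"
  shows "measure_pmf.expectation (replicate_pmf n p)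
      (\<lambda>xs. exp (\<epsilon> / 2 * (real (hits g' xs) - real (hits g xs)))) \<le> exp (- (real n * \<epsilon> * r / 4))"
proof -
  define h where "h = \<epsilon> / 2"
  have h: "0 < h" "h \<le> 1 / 2" using eps by (auto simp: h_def)
  have up: "exp h - 1 \<le> 2 * h"
  proof -
    have "h * h \<le> h * 1" using h by (intro mult_left_mono) auto
    moreover have "exp h \<le> 1 + h + h * h" using exp_bound[of h] h by (simp add: power2_eq_square)
    ultimately show ?thesis by linarith
  qed
  have lo: "3 * h / 4 \<le> 1 - exp (- h)" using exp_minus_le_linear[of h] h by simp
  have "measure_pmf.expectation p (\<lambda>x. exp (h * (of_bool (g' x) - of_bool (g x))))
      \<le> measure_pmf.expectation p (\<lambda>x. 1 + (exp h - 1) * indicator {x. g' x} x - (1 - exp (- h)) * indicator {x. g x} x)"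
  proof (rule expectation_mono_finite[OF p])
    \<comment> \<open>This settles the entries in both events, where the left side is 1 and the
      right side is \<open>exp h + exp (- h) - 1\<close>.\<close>
    have "1 \<le> (exp h - 1) + exp (- h)" using exp_ge_add_one_self[of h] exp_ge_add_one_self[of "-h"] by linarith
    then show "exp (h * (of_bool (g' x) - of_bool (g x)))
        \<le> 1 + (exp h - 1) * indicator {x. g' x} x - (1 - exp (- h)) * indicator {x. g x} x" for x
      by (auto simp: indicator_def)
  qed
  also have "\<dots> = 1 + (exp h - 1) * measure_pmf.prob p {x. g' x} - (1 - exp (- h)) * measure_pmf.prob p {x. g x}"
    by (subst Bochner_Integration.integral_diff Bochner_Integration.integral_add,
        (rule integrable_measure_pmf_finite[OF p])+)+ simp
  also have "\<dots> \<le> 1 + 2 * h * (r / 8) - 3 * h / 4 * r"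
    using up lo g h \<open>0 \<le> r\<close> by (intro add_mono diff_mono mult_mono) auto
  also have "\<dots> = 1 + - (\<epsilon> * r / 4)" by (simp add: h_def field_simps)
  also have "\<dots> \<le> exp (- (\<epsilon> * r / 4))" by (rule exp_ge_add_one_self)
  finally have one: "measure_pmf.expectation p (\<lambda>x. exp (h * (of_bool (g' x) - of_bool (g x)))) \<le> exp (- (\<epsilon> * r / 4))" .
  have "measure_pmf.expectation (replicate_pmf n p)
      (\<lambda>xs. exp (\<epsilon> / 2 * (real (hits g' xs) - real (hits g xs))))
    = measure_pmf.expectation p (\<lambda>x. exp (h * (of_bool (g' x) - of_bool (g x)))) ^ n"
    unfolding exp_hits_diff h_def by (rule expectation_replicate_prod_list[OF p])
  also have "\<dots> \<le> exp (- (\<epsilon> * r / 4)) ^ n" using one by (intro power_mono) auto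
  also have "\<dots> = exp (- (real n * \<epsilon> * r / 4))" by (simp add: exp_of_nat_mult[symmetric] mult.assoc)
  finally show ?thesis .
qed

text \<open>For a bad \<open>x\<close> with witness \<open>g\<close>, the probability of selecting
  \<open>x\<close> is at most the ratio of its weight to that of the good candidate
  \<open>a\<close>. The member of \<open>G a\<close> attaining the score depends on the sample, so
  the maximum is bounded by a sum over \<open>G a\<close>, each term of which is covered by
  \<open>expectation_exp_hits_diff\<close>. Summing over the bad \<open>x\<close> costs the factor
  \<open>card A\<close>.\<close>

theorem select_accurate:
  assumes p: "finite (set_pmf p)" and eps: "0 < \<epsilon>" "\<epsilon> \<le> 1" and r: "0 \<le> r"
    and A: "finite A" "a \<in> A" and G: "\<And>x. x \<in> A \<Longrightarrow> finite (G x) \<and> G x \<noteq> {}"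
    and a: "\<And>g. g \<in> G a \<Longrightarrow> measure_pmf.prob p {z. g z} \<le> r / 8"
  shows "measure_pmf.prob (bind_pmf (replicate_pmf n p) (select \<epsilon> A G))
      {x. \<exists>g\<in>G x. r < measure_pmf.prob p {z. g z}}
    \<le> real (card A) * real (card (G a)) * exp (- (real n * \<epsilon> * r / 4))"
    (is "measure_pmf.prob ?M ?B \<le> _ * _ * ?e")
proof -
  have finr: "finite (set_pmf (replicate_pmf n p))" by (rule finite_set_replicate_pmf[OF p])
  have one: "pmf ?M x \<le> real (card (G a)) * ?e" if x: "x \<in> A" "x \<in> ?B" for x
  proof -
    obtain g where g: "g \<in> G x" "r < measure_pmf.prob p {z. g z}" using x by auto
    have "pmf ?M x = measure_pmf.expectation (replicate_pmf n p) (\<lambda>xs. pmf (select \<epsilon> A G xs) x)"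
      by (rule pmf_bind)
    also have "\<dots> \<le> measure_pmf.expectation (replicate_pmf n p)
        (\<lambda>xs. \<Sum>g'\<in>G a. exp (\<epsilon> / 2 * (real (hits g' xs) - real (hits g xs))))"
    proof (rule expectation_mono_finite[OF finr])
      fix xs
      have "score (G a) xs \<in> (\<lambda>g. hits g xs) ` G a" unfolding score_def using G[OF A(2)] by (intro Max_in) auto
      then obtain g' where g': "g' \<in> G a" "score (G a) xs = hits g' xs" by auto
      have "hits g xs \<le> score (G x) xs" unfolding score_def using g G[OF x(1)] by auto
      have "pmf (select \<epsilon> A G xs) x
          \<le> exp (- (\<epsilon> / 2) * real (score (G x) xs)) / exp (- (\<epsilon> / 2) * real (score (G a) xs))"
        unfolding select_def using A x by (intro pmf_exp_mech_le) auto
      also have "\<dots> = exp (\<epsilon> / 2 * (real (score (G a) xs) - real (score (G x) xs)))"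
        by (simp add: exp_diff[symmetric] algebra_simps diff_divide_distrib)
      also have "\<dots> \<le> exp (\<epsilon> / 2 * (real (hits g' xs) - real (hits g xs)))"
        using g' \<open>hits g xs \<le> _\<close> eps by (simp add: mult_left_mono)
      also have "\<dots> \<le> (\<Sum>g'\<in>G a. exp (\<epsilon> / 2 * (real (hits g' xs) - real (hits g xs))))"
        using g' G[OF A(2)] by (intro member_le_sum) auto
      finally show "pmf (select \<epsilon> A G xs) x \<le> \<dots>" .
    qed
    also have "\<dots> = (\<Sum>g'\<in>G a. measure_pmf.expectation (replicate_pmf n p)
        (\<lambda>xs. exp (\<epsilon> / 2 * (real (hits g' xs) - real (hits g xs)))))"
      by (intro Bochner_Integration.integral_sum integrable_measure_pmf_finite finr)
    also have "\<dots> \<le> (\<Sum>g'\<in>G a. ?e)"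
      using g a by (intro sum_mono expectation_exp_hits_diff p eps r) auto
    finally show ?thesis by simp
  qed
  have "set_pmf ?M \<subseteq> A" using set_select[OF A(1)] A(2) by (fastforce simp: set_bind_pmf)
  then have "measure_pmf.prob ?M ?B = measure_pmf.prob ?M (?B \<inter> A)"
    by (intro measure_prob_cong_0) (auto simp: set_pmf_eq)
  also have "\<dots> = (\<Sum>x\<in>?B \<inter> A. pmf ?M x)" using A by (intro measure_measure_pmf_finite) auto
  also have "\<dots> \<le> (\<Sum>x\<in>?B \<inter> A. real (card (G a)) * ?e)" using one by (intro sum_mono) auto
  also have "\<dots> = real (card (?B \<inter> A)) * (real (card (G a)) * ?e)" by simp
  also have "\<dots> \<le> real (card A) * (real (card (G a)) * ?e)"
    using A by (intro mult_right_mono) (auto intro: card_mono)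
  finally show ?thesis by (simp add: mult.assoc)
qed

section \<open>A two-stage private learner\<close>

lemma map_replicate_pmf: "map_pmf (map f) (replicate_pmf n p) = replicate_pmf n (map_pmf f p)"
proof (induction n)
  case (Suc n)
  have "map_pmf (map f) (replicate_pmf (Suc n) p)
      = bind_pmf p (\<lambda>x. map_pmf ((#) (f x)) (map_pmf (map f) (replicate_pmf n p)))"
    by (simp add: map_pmf_def bind_assoc_pmf bind_return_pmf)
  then show ?case unfolding Suc by (simp add: map_pmf_def bind_assoc_pmf bind_return_pmf)
qed simp

text \<open>Outcomes in \<open>B\<close> are charged probability 1, all others at most
  \<open>b\<close>.\<close>

lemma prob_bind_le:
  assumes p: "finite (set_pmf p)" and f: "\<And>x. x \<in> set_pmf p \<Longrightarrow> finite (set_pmf (f x))"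
    and b: "0 \<le> b" "\<And>x. x \<in> set_pmf p \<Longrightarrow> x \<notin> B \<Longrightarrow> measure_pmf.prob (f x) F \<le> b"
  shows "measure_pmf.prob (bind_pmf p f) F \<le> measure_pmf.prob p B + b"
proof -
  have "measure_pmf.prob (bind_pmf p f) F = measure_pmf.expectation (bind_pmf p f) (indicator F)" by simp
  also have "\<dots> = measure_pmf.expectation p (\<lambda>x. measure_pmf.expectation (f x) (indicator F))"
    by (rule expectation_bind_finite[OF p f])
  also have "\<dots> = measure_pmf.expectation p (\<lambda>x. measure_pmf.prob (f x) F)" by simp
  also have "\<dots> \<le> measure_pmf.expectation p (\<lambda>x. indicator B x + b)"
  proof (rule expectation_mono_finite[OF p])
    fix x assume x: "x \<in> set_pmf p"
    show "measure_pmf.prob (f x) F \<le> indicator B x + b"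
    proof (cases "x \<in> B")
      case True
      have "measure_pmf.prob (f x) F \<le> 1" by simp
      then have "measure_pmf.prob (f x) F \<le> 1 + b" using b(1) by linarith
      then show ?thesis using True by simp
    qed (use b x in simp)
  qed
  also have "\<dots> = measure_pmf.prob p B + b"
    by (subst Bochner_Integration.integral_add) (simp_all add: integrable_measure_pmf_finite[OF p])
  finally show ?thesis .
qed

text \<open>With \<delta> = 0, privacy can be checked one outcome at a time.\<close>

lemma prob_le_of_pmf_le:
  assumes "finite (set_pmf p)" "0 \<le> b" "\<And>x. pmf p x \<le> b * pmf q x"
  shows "measure_pmf.prob p F \<le> b * measure_pmf.prob q F"
proof -
  have "measure_pmf.prob p F = measure_pmf.prob p (F \<inter> set_pmf p)" by (simp add: measure_Int_set_pmf)
  also have "\<dots> = (\<Sum>x\<in>F \<inter> set_pmf p. pmf p x)" using assms by (intro measure_measure_pmf_finite) auto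
  also have "\<dots> \<le> (\<Sum>x\<in>F \<inter> set_pmf p. b * pmf q x)" using assms by (intro sum_mono)
  also have "\<dots> = b * measure_pmf.prob q (F \<inter> set_pmf p)"
    using assms by (subst measure_measure_pmf_finite) (auto simp: sum_distrib_left)
  also have "\<dots> \<le> b * measure_pmf.prob q F"
    using assms by (intro mult_left_mono measure_pmf.finite_measure_mono) auto
  finally show ?thesis .
qed

text \<open>The factor \<open>b\<close> may come from either stage: from \<open>p\<close> against
  \<open>q\<close> with equal kernels, or from \<open>f\<close> against \<open>g\<close> with equal
  first stages.\<close>

lemma pmf_bind_ratio:
  assumes "finite A" "set_pmf p \<subseteq> A" "set_pmf q \<subseteq> A" "\<And>x. x \<in> A \<Longrightarrow> pmf p x * pmf (f x) y \<le> b * (pmf q x * pmf (g x) y)"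
  shows "pmf (bind_pmf p f) y \<le> b * pmf (bind_pmf q g) y"
proof -
  have "pmf (bind_pmf p f) y = (\<Sum>x\<in>A. pmf p x * pmf (f x) y)"
    using assms unfolding pmf_bind by (subst integral_measure_pmf[of A]) auto
  also have "\<dots> \<le> (\<Sum>x\<in>A. b * (pmf q x * pmf (g x) y))" using assms by (intro sum_mono) auto
  also have "\<dots> = b * pmf (bind_pmf q g) y"
    using assms unfolding pmf_bind by (subst integral_measure_pmf[of A]) (auto simp: sum_distrib_left)
  finally show ?thesis .
qed

text \<open>A missing label counts as an error of every hypothesis. This concerns only privacy,
  which quantifies over arbitrary labels; in a sample given by \<open>semi_label\<close> the second
  stage sees labeled entries only.\<close>

definition mislabels :: "('x \<Rightarrow> bool) \<Rightarrow> 'x \<times> bool option \<Rightarrow> bool" where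
  "mislabels h z \<longleftrightarrow> snd z \<noteq> Some (h (fst z))"

definition two_stage :: "real \<Rightarrow> nat \<Rightarrow> ('x list \<Rightarrow> 't pmf) \<Rightarrow> ('t \<Rightarrow> ('x \<Rightarrow> bool) set) \<Rightarrow> 'x learner" where
  "two_stage \<epsilon> m M H D = bind_pmf (M (map fst (drop m D)))
     (\<lambda>t. select \<epsilon> (H t) (\<lambda>h. {mislabels h}) (take m D))"

lemma prob_mislabels:
  "measure_pmf.prob (map_pmf (\<lambda>x. (x, Some (c x))) p) {z. mislabels h z} = pred_error p c h"
  by (simp add: pred_error_def mislabels_def vimage_def eq_commute)

text \<open>The first stage does not see the labeled examples, so these can be drawn after it.\<close>

lemma two_stage_semi_label:
  "bind_pmf (replicate_pmf (m + n) p) (\<lambda>xs. two_stage \<epsilon> m M H (semi_label c m xs))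
    = bind_pmf (bind_pmf (replicate_pmf n p) M) (\<lambda>t.
        bind_pmf (replicate_pmf m (map_pmf (\<lambda>x. (x, Some (c x))) p)) (select \<epsilon> (H t) (\<lambda>h. {mislabels h})))"
proof -
  let ?lab = "map (\<lambda>x. (x, Some (c x)))"
  let ?S = "\<lambda>t. select \<epsilon> (H t) (\<lambda>h. {mislabels h})"
  have "bind_pmf (replicate_pmf (m + n) p) (\<lambda>xs. two_stage \<epsilon> m M H (semi_label c m xs))
      = bind_pmf (replicate_pmf m p) (\<lambda>xs. bind_pmf (replicate_pmf n p)
          (\<lambda>ys. two_stage \<epsilon> m M H (semi_label c m (xs @ ys))))"
    by (simp add: replicate_pmf_distrib bind_assoc_pmf bind_return_pmf)
  also have "\<dots> = bind_pmf (replicate_pmf m p) (\<lambda>xs. bind_pmf (replicate_pmf n p)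
          (\<lambda>ys. bind_pmf (M ys) (\<lambda>t. ?S t (?lab xs))))"
  proof (intro bind_pmf_cong refl)
    fix xs ys assume "xs \<in> set_pmf (replicate_pmf m p)"
    then have "length xs = m" by (simp add: set_replicate_pmf)
    then show "two_stage \<epsilon> m M H (semi_label c m (xs @ ys)) = bind_pmf (M ys) (\<lambda>t. ?S t (?lab xs))"
      by (simp add: two_stage_def semi_label_def comp_def)
  qed
  also have "\<dots> = bind_pmf (replicate_pmf n p) (\<lambda>ys. bind_pmf (replicate_pmf m p)
          (\<lambda>xs. bind_pmf (M ys) (\<lambda>t. ?S t (?lab xs))))"
    by (rule bind_commute_pmf)
  also have "\<dots> = bind_pmf (replicate_pmf n p) (\<lambda>ys. bind_pmf (M ys) (\<lambda>t.
          bind_pmf (replicate_pmf m p) (\<lambda>xs. ?S t (?lab xs))))"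
    by (subst bind_commute_pmf) (rule refl)
  also have "\<dots> = bind_pmf (bind_pmf (replicate_pmf n p) M) (\<lambda>t. bind_pmf (map_pmf ?lab (replicate_pmf m p)) (?S t))"
    by (simp add: bind_assoc_pmf bind_map_pmf)
  finally show ?thesis by (simp add: map_replicate_pmf)
qed

text \<open>The first stage is abstract because it is instantiated twice: by a private choice of
  points and by a trivial stage that keeps all of \<open>C\<close>. \<open>\<beta>\<close> and
  \<open>\<beta>'\<close> are the failure probabilities of the two stages. The first stage must
  offer a hypothesis of error at most \<open>\<alpha> / 8\<close>, since
  \<open>select_accurate\<close> compares bad candidates with one that is eight times
  better.\<close>

locale two_stage_learner =
  fixes X :: "'x set" and C :: "('x \<Rightarrow> bool) set" and \<epsilon> \<alpha> \<beta> \<beta>' N :: real and m n :: nat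
    and T :: "'t set" and M :: "'x list \<Rightarrow> 't pmf" and H :: "'t \<Rightarrow> ('x \<Rightarrow> bool) set"
  assumes X: "finite X" and C: "finite C" and \<epsilon>: "0 < \<epsilon>" "\<epsilon> \<le> 1" and \<alpha>: "0 \<le> \<alpha>"
    and T: "finite T" "\<And>ys. set_pmf (M ys) \<subseteq> T"
    and H: "\<And>t. t \<in> T \<Longrightarrow> H t \<noteq> {} \<and> H t \<subseteq> C \<and> real (card (H t)) \<le> N"
    and M_private: "\<And>ys ys' t. near ys ys' \<Longrightarrow> pmf (M ys) t \<le> exp \<epsilon> * pmf (M ys') t"
    and M_accurate: "\<And>c p. c \<in> C \<Longrightarrow> set_pmf p \<subseteq> X \<Longrightarrow>
      measure_pmf.prob (bind_pmf (replicate_pmf n p) M) {t. \<forall>h\<in>H t. \<alpha> / 8 < pred_error p c h} \<le> \<beta>"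
    and N: "0 \<le> N" "N * exp (- (real m * \<epsilon> * \<alpha> / 4)) \<le> \<beta>'"
begin

lemma finite_H: "t \<in> T \<Longrightarrow> finite (H t)"
  using H C finite_subset by blast

lemma set_two_stage: "set_pmf (two_stage \<epsilon> m M H D) \<subseteq> C"
proof -
  have "set_pmf (select \<epsilon> (H t) (\<lambda>h. {mislabels h}) (take m D)) \<subseteq> C" if "t \<in> T" for t
    using set_select[OF finite_H[OF that]] H[OF that] by (meson order_trans)
  then show ?thesis using T by (fastforce simp: two_stage_def set_bind_pmf)
qed

lemma two_stage_proper: "proper_learner X C k (two_stage \<epsilon> m M H)"
  using set_two_stage by (auto simp: proper_learner_def)

text \<open>A change in the tail affects only the distribution of \<open>t\<close>, a change in the
  head only the selection given \<open>t\<close>; either way the factor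
  \<open>exp \<epsilon>\<close> is paid once.\<close>

lemma two_stage_private: "differentially_private (DB :: ('x \<times> bool option) list set) \<epsilon> 0 (two_stage \<epsilon> m M H)"
  unfolding differentially_private_def
proof (intro ballI impI allI)
  fix D D' :: "('x \<times> bool option) list" and F assume "neighboring D D'"
  then have "near D D'" by (rule neighboring_imp_near)
  then have "pmf (two_stage \<epsilon> m M H D) h \<le> exp \<epsilon> * pmf (two_stage \<epsilon> m M H D') h" for h
  proof (cases rule: near_cases[of _ _ m])
    case 1
    show ?thesis unfolding two_stage_def 1(1)
    proof (rule pmf_bind_ratio[OF T(1) T(2) T(2)])
      fix t
      have "pmf (M (map fst (drop m D))) t \<le> exp \<epsilon> * pmf (M (map fst (drop m D'))) t"
        by (intro M_private near_map 1(2))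
      then show "pmf (M (map fst (drop m D))) t * pmf (select \<epsilon> (H t) (\<lambda>h. {mislabels h}) (take m D')) h
        \<le> exp \<epsilon> * (pmf (M (map fst (drop m D'))) t * pmf (select \<epsilon> (H t) (\<lambda>h. {mislabels h}) (take m D')) h)"
        by (simp add: mult_right_mono mult.assoc[symmetric])
    qed
  next
    case 2
    show ?thesis unfolding two_stage_def 2(2)
    proof (rule pmf_bind_ratio[OF T(1) T(2) T(2)])
      fix t assume t: "t \<in> T"
      have "pmf (select \<epsilon> (H t) (\<lambda>h. {mislabels h}) (take m D)) h
          \<le> exp \<epsilon> * pmf (select \<epsilon> (H t) (\<lambda>h. {mislabels h}) (take m D')) h"
        using H[OF t] finite_H[OF t] \<epsilon> 2(1) by (intro select_private) auto
      then show "pmf (M (map fst (drop m D'))) t * pmf (select \<epsilon> (H t) (\<lambda>h. {mislabels h}) (take m D)) h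
        \<le> exp \<epsilon> * (pmf (M (map fst (drop m D'))) t * pmf (select \<epsilon> (H t) (\<lambda>h. {mislabels h}) (take m D')) h)"
        by (subst mult.left_commute) (rule mult_left_mono, simp_all)
    qed
  qed
  then have "measure_pmf.prob (two_stage \<epsilon> m M H D) F \<le> exp \<epsilon> * measure_pmf.prob (two_stage \<epsilon> m M H D') F"
    using finite_subset[OF set_two_stage C] by (intro prob_le_of_pmf_le) auto
  then show "measure_pmf.prob (two_stage \<epsilon> m M H D) F \<le> exp \<epsilon> * measure_pmf.prob (two_stage \<epsilon> m M H D') F + 0"
    by simp
qed

text \<open>Once the labeled part is drawn after the first stage, a good \<open>t\<close> is fixed
  and \<open>select_accurate\<close> applies to labeled examples with \<open>r = \<alpha>\<close>;
  the probability of a mislabeled example is the error of the hypothesis.\<close>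

lemma two_stage_SSL: "SSL X C \<alpha> (\<beta> + \<beta>') (m + n) m (two_stage \<epsilon> m M H)"
  unfolding SSL_def
proof (intro conjI ballI allI impI)
  fix c p assume c: "c \<in> C" and p: "set_pmf p \<subseteq> X"
  have finp: "finite (set_pmf p)" using p X finite_subset by auto
  let ?p' = "map_pmf (\<lambda>x. (x, Some (c x))) p"
  let ?G = "\<lambda>h. {mislabels h}"
  let ?M = "bind_pmf (replicate_pmf n p) M"
  have setM: "set_pmf ?M \<subseteq> T" using T(2) by (auto simp: set_bind_pmf)
  have "measure_pmf.prob (bind_pmf ?M (\<lambda>t. bind_pmf (replicate_pmf m ?p') (select \<epsilon> (H t) ?G)))
      {h. \<alpha> < pred_error p c h} \<le> measure_pmf.prob ?M {t. \<forall>h\<in>H t. \<alpha> / 8 < pred_error p c h} + \<beta>'"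
  proof (rule prob_bind_le)
    show "finite (set_pmf ?M)" by (rule finite_subset[OF setM T(1)])
    fix t assume "t \<in> set_pmf ?M"
    then have t: "t \<in> T" using setM by auto
    have Ht: "finite (H t)" "H t \<noteq> {}" using H[OF t] finite_H[OF t] by auto
    have "set_pmf (bind_pmf (replicate_pmf m ?p') (select \<epsilon> (H t) ?G)) \<subseteq> H t"
      using set_select[OF Ht] by (fastforce simp: set_bind_pmf)
    then show "finite (set_pmf (bind_pmf (replicate_pmf m ?p') (select \<epsilon> (H t) ?G)))"
      by (rule finite_subset) (rule Ht)
    assume "t \<notin> {t. \<forall>h\<in>H t. \<alpha> / 8 < pred_error p c h}"
    then obtain h where h: "h \<in> H t" "pred_error p c h \<le> \<alpha> / 8" by (auto simp: not_less)
    have "measure_pmf.prob (bind_pmf (replicate_pmf m ?p') (select \<epsilon> (H t) ?G))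
        {h. \<exists>g\<in>?G h. \<alpha> < measure_pmf.prob ?p' {z. g z}}
      \<le> real (card (H t)) * real (card (?G h)) * exp (- (real m * \<epsilon> * \<alpha> / 4))"
    proof (rule select_accurate)
      show "measure_pmf.prob ?p' {z. g z} \<le> \<alpha> / 8" if "g \<in> ?G h" for g
        using h(2) that by (simp only: singleton_iff prob_mislabels)
    qed (use finp \<epsilon> \<alpha> Ht h in auto)
    also have "\<dots> \<le> N * exp (- (real m * \<epsilon> * \<alpha> / 4))" using H[OF t] by simp
    also note N(2)
    finally show "measure_pmf.prob (bind_pmf (replicate_pmf m ?p') (select \<epsilon> (H t) ?G))
        {h. \<alpha> < pred_error p c h} \<le> \<beta>'"
      by (simp add: prob_mislabels del: measure_map_pmf)
  next
    have "0 \<le> N * exp (- (real m * \<epsilon> * \<alpha> / 4))" using N by simp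
    then show "0 \<le> \<beta>'" using N(2) by linarith
  qed
  also have "\<dots> \<le> \<beta> + \<beta>'" using M_accurate[OF c p] by simp
  finally show "measure_pmf.prob (bind_pmf (replicate_pmf (m + n) p)
      (\<lambda>xs. two_stage \<epsilon> m M H (semi_label c m xs))) {h. \<alpha> < pred_error p c h} \<le> \<beta> + \<beta>'"
    unfolding two_stage_semi_label .
qed simp

theorem two_stage_PSSL: "PSSL X C \<alpha> (\<beta> + \<beta>') \<epsilon> 0 (m + n) m (two_stage \<epsilon> m M H)"
  unfolding PSSL_def using two_stage_SSL two_stage_private by blast

end

section \<open>Privately chosen nets and the resulting learners\<close>

definition disagreements :: "('x \<Rightarrow> bool) set \<Rightarrow> 'x list \<Rightarrow> ('x \<Rightarrow> bool) set" where
  "disagreements C t = (\<lambda>(c, c') x. c x \<noteq> c' x) ` {(c, c') \<in> C \<times> C. \<forall>x\<in>set t. c x = c' x}"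

lemma disagreements:
  assumes "finite C"
  shows "finite (disagreements C t)" "C \<noteq> {} \<Longrightarrow> disagreements C t \<noteq> {}"
    and "card (disagreements C t) \<le> (card C)\<^sup>2"
proof -
  have sub: "{(c, c') \<in> C \<times> C. \<forall>x\<in>set t. c x = c' x} \<subseteq> C \<times> C" by auto
  then have fin: "finite {(c, c') \<in> C \<times> C. \<forall>x\<in>set t. c x = c' x}"
    using assms finite_subset by blast
  then show "finite (disagreements C t)" unfolding disagreements_def by simp
  show "disagreements C t \<noteq> {}" if "C \<noteq> {}" using that unfolding disagreements_def by auto
  have "card (disagreements C t) \<le> card {(c, c') \<in> C \<times> C. \<forall>x\<in>set t. c x = c' x}"
    unfolding disagreements_def by (rule card_image_le[OF fin])
  also have "\<dots> \<le> card (C \<times> C)" using sub assms by (intro card_mono) auto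
  finally show "card (disagreements C t) \<le> (card C)\<^sup>2" by (simp add: card_cartesian_product power2_eq_square)
qed

text \<open>A factor 8 of accuracy is lost in each stage: a net for \<open>\<alpha> / 64\<close>
  exists, the first stage finds one for \<open>\<alpha> / 8\<close>, the second a hypothesis for
  \<open>\<alpha>\<close>, each failing with probability at most \<open>\<beta> / 2\<close>.
  \<open>N2\<close> serves the existence of the net, \<open>N1\<close> counts second-stage
  candidates. The first stage has \<open>card X ^ k\<close> candidates; as it sees no labels, its
  families range over all pairs from \<open>C\<close>, hence the square of
  \<open>card C\<close>.\<close>

theorem net_learner:
  fixes C :: "('x \<Rightarrow> bool) set"
  assumes X: "finite X" "X \<noteq> {}" and C: "finite C" "C \<noteq> {}"
    and eps: "0 < \<epsilon>" "\<epsilon> \<le> 1" and \<alpha>: "0 \<le> \<alpha>"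
    and N2: "\<And>Y. Y \<subseteq> X \<Longrightarrow> card Y \<le> 2 * k \<Longrightarrow> real (card (traces C Y)) \<le> N2" "N2\<^sup>2 < (1 + \<alpha> / 64) ^ k"
    and N1: "\<And>Y. Y \<subseteq> X \<Longrightarrow> card Y \<le> k \<Longrightarrow> real (card (traces C Y)) \<le> N1"
    and m: "N1 * exp (- (real m * \<epsilon> * \<alpha> / 4)) \<le> \<beta> / 2"
    and n: "real (card X ^ k) * (real (card C))\<^sup>2 * exp (- (real n * \<epsilon> * \<alpha> / 32)) \<le> \<beta> / 2"
  shows "\<exists>A. PSSL X C \<alpha> \<beta> \<epsilon> 0 (m + n) m A \<and> proper_learner X C (m + n) A"
proof -
  define T where "T = {xs. set xs \<subseteq> X \<and> length xs = k}"
  define M where "M = select \<epsilon> T (disagreements C)"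
  define H where "H t = representative C (set t) ` C" for t
  have T: "finite T" "card T = card X ^ k"
    unfolding T_def using X by (auto intro: finite_lists_length_eq simp: card_lists_length_eq)
  obtain x where "x \<in> X" using X by auto
  then have "replicate k x \<in> T" by (auto simp: T_def)
  then have T_ne: "T \<noteq> {}" by auto
  interpret two_stage_learner X C \<epsilon> \<alpha> "\<beta> / 2" "\<beta> / 2" N1 m n T M H
  proof
    show "finite X" "finite C" "0 < \<epsilon>" "\<epsilon> \<le> 1" "0 \<le> \<alpha>" "finite T" by fact+
    show "set_pmf (M ys) \<subseteq> T" for ys unfolding M_def by (rule set_select[OF T(1) T_ne])
    show "H t \<noteq> {} \<and> H t \<subseteq> C \<and> real (card (H t)) \<le> N1" if "t \<in> T" for t
    proof (intro conjI)
      show "H t \<noteq> {}" "H t \<subseteq> C" using C representative(1) by (auto simp: H_def)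
      have "card (H t) \<le> card (traces C (set t))" unfolding H_def by (rule card_representatives) simp
      also have "real (card (traces C (set t))) \<le> N1"
        using that card_length[of t] by (intro N1) (auto simp: T_def)
      finally show "real (card (H t)) \<le> N1" by simp
    qed
    have "real (card (traces C {})) \<le> N1" by (rule N1) auto
    then show "0 \<le> N1" by linarith
    show "pmf (M ys) t \<le> exp \<epsilon> * pmf (M ys') t" if "near ys ys'" for ys ys' t
      unfolding M_def using disagreements C T T_ne eps that by (intro select_private) auto
    show "N1 * exp (- (real m * \<epsilon> * \<alpha> / 4)) \<le> \<beta> / 2" by fact
    fix c p assume c: "c \<in> C" and p: "set_pmf p \<subseteq> X"
    obtain a where a: "length a = k" "set a \<subseteq> X"
      "\<And>c c'. c \<in> C \<Longrightarrow> c' \<in> C \<Longrightarrow> \<forall>x\<in>set a. c x = c' x \<Longrightarrow> measure_pmf.prob p {x. c x \<noteq> c' x} \<le> \<alpha> / 64"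
      using exists_net[OF X(1) p N2(1) N2(2)] \<alpha> by auto
    have "measure_pmf.prob (bind_pmf (replicate_pmf n p) M) {t. \<forall>h\<in>H t. \<alpha> / 8 < pred_error p c h}
        \<le> measure_pmf.prob (bind_pmf (replicate_pmf n p) M)
          {t. \<exists>g\<in>disagreements C t. \<alpha> / 8 < measure_pmf.prob p {x. g x}}"
    proof (intro measure_pmf.finite_measure_mono)
      show "{t. \<forall>h\<in>H t. \<alpha> / 8 < pred_error p c h}
          \<subseteq> {t. \<exists>g\<in>disagreements C t. \<alpha> / 8 < measure_pmf.prob p {x. g x}}"
      proof
        \<comment> \<open>The representative of the target \<open>c\<close> agrees with
          \<open>c\<close> on \<open>t\<close>, so if even it is far from \<open>c\<close>, the two
          form a pair witnessing that \<open>t\<close> is no net for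
          \<open>\<alpha> / 8\<close>.\<close>
        fix t assume "t \<in> {t. \<forall>h\<in>H t. \<alpha> / 8 < pred_error p c h}"
        then have far: "\<alpha> / 8 < measure_pmf.prob p {x. representative C (set t) c x \<noteq> c x}"
          using c by (auto simp: H_def pred_error_def)
        have "(\<lambda>x. representative C (set t) c x \<noteq> c x) \<in> disagreements C t"
          unfolding disagreements_def
          by (rule image_eqI[of _ _ "(representative C (set t) c, c)"]) (use c representative[OF c] in auto)
        then show "t \<in> {t. \<exists>g\<in>disagreements C t. \<alpha> / 8 < measure_pmf.prob p {x. g x}}"
          using far by blast
      qed
    qed simp
    also have "\<dots> \<le> real (card T) * real (card (disagreements C a)) * exp (- (real n * \<epsilon> * (\<alpha> / 8) / 4))"
      unfolding M_def
    proof (rule select_accurate)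
      show "finite (set_pmf p)" using p X finite_subset by auto
      show "a \<in> T" using a by (simp add: T_def)
      show "measure_pmf.prob p {z. g z} \<le> \<alpha> / 8 / 8" if "g \<in> disagreements C a" for g
        using that a(3) by (auto simp: disagreements_def)
    qed (use eps \<alpha> T disagreements C in auto)
    also have "\<dots> \<le> real (card T) * (real (card C))\<^sup>2 * exp (- (real n * \<epsilon> * (\<alpha> / 8) / 4))"
      using disagreements(3)[OF C(1), of a] by (intro mult_right_mono mult_left_mono) (simp_all flip: of_nat_power)
    also have "\<dots> \<le> \<beta> / 2" using n by (simp add: T mult.assoc)
    finally show "measure_pmf.prob (bind_pmf (replicate_pmf n p) M) {t. \<forall>h\<in>H t. \<alpha> / 8 < pred_error p c h} \<le> \<beta> / 2" .
  qed
  show ?thesis using two_stage_PSSL two_stage_proper by (intro exI[of _ "two_stage \<epsilon> m M H"]) simp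
qed

text \<open>The exponential mechanism on all of \<open>C\<close>: a single first-stage outcome and
  no unlabeled examples. The first stage cannot fail, because the target itself is in
  \<open>C\<close> with error 0.\<close>

theorem finite_class_learner:
  fixes C :: "('x \<Rightarrow> bool) set"
  assumes "finite X" "finite C" "C \<noteq> {}" "0 < \<epsilon>" "\<epsilon> \<le> 1" "0 \<le> \<alpha>"
    and "real (card C) * exp (- (real m * \<epsilon> * \<alpha> / 4)) \<le> \<beta>"
  shows "\<exists>A. PSSL X C \<alpha> \<beta> \<epsilon> 0 m m A \<and> proper_learner X C m A"
proof -
  interpret two_stage_learner X C \<epsilon> \<alpha> 0 \<beta> "real (card C)" m 0 "{()}" "\<lambda>_. return_pmf ()" "\<lambda>_. C"
  proof
    show "pmf (return_pmf ()) t \<le> exp \<epsilon> * pmf (return_pmf ()) t" for t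
      using \<open>0 < \<epsilon>\<close> by simp
    fix c p assume "c \<in> C"
    then have "{t :: unit. \<forall>h\<in>C. \<alpha> / 8 < pred_error p c h} = {}"
      using \<open>0 \<le> \<alpha>\<close> by (auto simp: pred_error_def intro!: bexI[of _ c])
    then show "measure_pmf.prob (bind_pmf (replicate_pmf 0 p) (\<lambda>_. return_pmf ()))
        {t. \<forall>h\<in>C. \<alpha> / 8 < pred_error p c h} \<le> 0" by simp
  qed (use assms in auto)
  show ?thesis using two_stage_PSSL two_stage_proper
    by (intro exI[of _ "two_stage \<epsilon> m (\<lambda>_. return_pmf ()) (\<lambda>_. C)"]) simp
qed

section \<open>Sample sizes\<close>

lemma PSSL_mono_privacy:
  assumes "PSSL X C \<alpha> \<beta> \<epsilon> \<delta> n m A" "\<epsilon> \<le> \<epsilon>'"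
  shows "PSSL X C \<alpha> \<beta> \<epsilon>' \<delta> n m A"
proof -
  have *: "exp \<epsilon> * x + \<delta> \<le> exp \<epsilon>' * x + \<delta>" if "0 \<le> x" for x
    using that assms(2) by (simp add: mult_right_mono)
  show ?thesis using assms(1) unfolding PSSL_def differentially_private_def
    by (meson * measure_nonneg order_trans)
qed

lemma nat_ceiling_bounds:
  assumes "0 \<le> (t::real)"
  shows "t \<le> real (nat \<lceil>t\<rceil>)" "real (nat \<lceil>t\<rceil>) \<le> t + 1"
  using assms by linarith+

text \<open>With \<open>x = s / 16\<close> in the trace bound, the exponential part of its square is
  \<open>exp (k * s / 4)\<close>, and the condition on \<open>k\<close> keeps the other part below
  the same value. The product stays below \<open>(1 + s) ^ k\<close> because
  \<open>exp (s / 2) \<le> 1 + s\<close>.\<close>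

lemma net_size:
  fixes v :: nat and s :: real
  assumes "0 < s" "s \<le> 1" "8 * real v * ln (16 / s) / s < real k"
  shows "(exp (s / 16 * real (2 * k)) / (s / 16) ^ v)\<^sup>2 < (1 + s) ^ k"
proof -
  have "8 * real v * ln (16 / s) < real k * s" using assms by (simp add: field_simps)
  then have lt: "real k * s / 4 + 2 * real v * ln (16 / s) < real k * (s / 2)" by linarith
  have "1 / (s / 16) ^ v = exp (real v * ln (16 / s))"
    using assms by (simp add: exp_of_nat_mult power_divide power_one_over)
  then have "(exp (s / 16 * real (2 * k)) / (s / 16) ^ v)\<^sup>2 = (exp (s / 16 * real (2 * k)) * exp (real v * ln (16 / s)))\<^sup>2"
    by (metis times_divide_eq_right mult.right_neutral)
  also have "\<dots> = exp (real k * s / 4 + 2 * real v * ln (16 / s))"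
    by (simp add: power2_eq_square exp_add[symmetric] algebra_simps)
  also have "\<dots> < exp (real k * (s / 2))" using lt by simp
  also have "\<dots> = exp (s / 2) ^ k" by (rule exp_of_nat_mult)
  also have "\<dots> \<le> (1 + s) ^ k"
  proof (rule power_mono)
    have "s * s \<le> s * 1" using assms by (intro mult_left_mono) auto
    moreover have "exp (s / 2) \<le> 1 + s / 2 + (s / 2)\<^sup>2" using assms by (intro exp_bound) auto
    moreover have "(s / 2)\<^sup>2 = s * s / 4" by (simp add: power2_eq_square)
    ultimately show "exp (s / 2) \<le> 1 + s" using assms by linarith
  qed simp
  finally show ?thesis .
qed

text \<open>The dominant terms are of order
  \<open>v * ln (1 / \<alpha>) / (\<epsilon> * \<alpha>)\<close> for \<open>m\<close> and
  \<open>d * v * ln (1 / \<alpha>) / (\<epsilon> * \<alpha> ^ 2)\<close> for \<open>n\<close>, which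
  is stronger in \<open>\<alpha>\<close> than the final bounds.\<close>

lemma cube_learner:
  fixes C :: "(bool list \<Rightarrow> bool) set" and \<alpha> \<beta> \<epsilon> :: real
  assumes v_def: "v = vc_dim (cube d) C" and C: "concept_class (cube d) C" "C \<noteq> {}"
    and \<alpha>: "0 < \<alpha>" "\<alpha> < 1" and \<beta>: "0 < \<beta>" and eps: "0 < \<epsilon>" "\<epsilon> \<le> 1"
    and v: "1 \<le> v"
    and b_nonneg: "0 \<le> ln (1 / \<beta>)"
  shows "\<exists>n m A. PSSL (cube d) C \<alpha> \<beta> \<epsilon> 0 (m + n) m A \<and> proper_learner (cube d) C (m + n) A
    \<and> real m \<le> 4 * (real v * (5121 + 513 * ln (1 / \<alpha>)) + 1 + ln (1 / \<beta>)) / (\<epsilon> * \<alpha>) + 1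
    \<and> real n \<le> 32 * (real d * real v * (5123 + 512 * ln (1 / \<alpha>)) / \<alpha> + 3 + ln (1 / \<beta>)) / (\<epsilon> * \<alpha>) + 1"
proof -
  define a b where "a = ln (1 / \<alpha>)" and "b = ln (1 / \<beta>)"
  have a: "0 < a" "exp (- a) = \<alpha>" using \<alpha> by (simp_all add: a_def ln_div)
  have b: "0 \<le> b" "exp (- b) = \<beta>" using \<beta> b_nonneg by (simp_all add: b_def ln_div)
  have ln2: "ln 2 \<le> (1::real)" using ln_2_less_1 by simp
  \<comment> \<open>The extra 1 in the exponent pays for splitting \<open>\<beta>\<close> between
    the stages.\<close>
  have half: "exp (- (1 + b)) \<le> \<beta> / 2"
  proof -
    have "exp (-1::real) \<le> 1 / 2" using exp_ge_add_one_self[of 1] by (simp add: exp_minus field_simps)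
    moreover have "exp (- (1 + b)) = exp (-1) * \<beta>" unfolding b(2)[symmetric] exp_add[symmetric] by simp
    ultimately show ?thesis using \<beta> mult_right_mono[of "exp (-1)" "1/2" \<beta>] by simp
  qed
  \<comment> \<open>The threshold of \<open>net_size\<close> for \<open>s = \<alpha> / 64\<close>,
    where \<open>8 / s = 512 / \<alpha>\<close> and \<open>16 / s = 1024 / \<alpha>\<close>. Floor
    plus one makes the inequality strict.\<close>
  define k where "k = nat \<lfloor>512 * real v * ln (1024 / \<alpha>) / \<alpha>\<rfloor> + 1"
  have ln1024: "ln (1024 / \<alpha>) \<le> 10 + a" "0 \<le> ln (1024 / \<alpha>)"
  proof -
    have "ln (1024::real) = 10 * ln 2" using ln_realpow[of 2 10] by simp
    then show "ln (1024 / \<alpha>) \<le> 10 + a" using ln2 \<alpha> by (simp add: a_def ln_div)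
    show "0 \<le> ln (1024 / \<alpha>)" using \<alpha> by simp
  qed
  have k_gt: "512 * real v * ln (1024 / \<alpha>) / \<alpha> < real k"
    and k_le: "real k \<le> 512 * real v * ln (1024 / \<alpha>) / \<alpha> + 1"
  proof -
    have "0 \<le> 512 * real v * ln (1024 / \<alpha>) / \<alpha>" using ln1024 \<alpha> by simp
    then show "512 * real v * ln (1024 / \<alpha>) / \<alpha> < real k"
      "real k \<le> 512 * real v * ln (1024 / \<alpha>) / \<alpha> + 1" unfolding k_def by linarith+
  qed
  \<comment> \<open>5121 is 512 * 10, from \<open>ln 1024 \<le> 10\<close>, plus 1 for rounding,
    which is absorbed by \<open>\<alpha> \<le> 1 \<le> v\<close>.\<close>
  have k_alpha: "\<alpha> * real k \<le> real v * (5121 + 512 * a)"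
  proof -
    have "\<alpha> * real k \<le> \<alpha> * (512 * real v * ln (1024 / \<alpha>) / \<alpha> + 1)" using k_le \<alpha> by (intro mult_left_mono) auto
    also have "\<dots> = 512 * real v * ln (1024 / \<alpha>) + \<alpha>" using \<alpha> by (simp add: field_simps)
    also have "\<dots> \<le> 512 * real v * (10 + a) + real v" using ln1024 \<alpha> v by (intro add_mono mult_left_mono) auto
    finally show ?thesis by (simp add: algebra_simps)
  qed
  \<comment> \<open>The numerators are the logarithms to be beaten:
    \<open>\<alpha> * k + v * a\<close> for the second-stage candidates, and \<open>d * k\<close>
    plus \<open>2 + 2 * d * v\<close> for the first-stage candidates and the squared bound on
    \<open>card C\<close>. Each is increased by \<open>1 + b\<close> for
    \<open>\<beta> / 2\<close>.\<close>
  define m where "m = nat \<lceil>4 * (\<alpha> * real k + real v * a + 1 + b) / (\<epsilon> * \<alpha>)\<rceil>"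
  define n where "n = nat \<lceil>32 * (real d * real k + 2 * (real d * real v) + 3 + b) / (\<epsilon> * \<alpha>)\<rceil>"
  have m_ge: "4 * (\<alpha> * real k + real v * a + 1 + b) / (\<epsilon> * \<alpha>) \<le> real m"
    and m_le: "real m \<le> 4 * (\<alpha> * real k + real v * a + 1 + b) / (\<epsilon> * \<alpha>) + 1"
    unfolding m_def using a b \<alpha> eps by (auto intro!: nat_ceiling_bounds)
  have n_ge: "32 * (real d * real k + 2 * (real d * real v) + 3 + b) / (\<epsilon> * \<alpha>) \<le> real n"
    and n_le: "real n \<le> 32 * (real d * real k + 2 * (real d * real v) + 3 + b) / (\<epsilon> * \<alpha>) + 1"
    unfolding n_def using a b \<alpha> eps by (auto intro!: nat_ceiling_bounds)
  have ea: "0 < \<epsilon> * \<alpha>" using eps \<alpha> by simp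
  have traces_le: "real (card (traces C Y)) \<le> exp (x * real l) / x ^ v"
    if "Y \<subseteq> cube d" "card Y \<le> l" "0 < x" "x \<le> 1" for Y x l
  proof -
    have "real (card (traces C Y)) \<le> exp (x * real (card Y)) / x ^ v"
      unfolding v_def using that by (intro card_traces_le) auto
    also have "\<dots> \<le> exp (x * real l) / x ^ v" using that by (intro divide_right_mono) auto
    finally show ?thesis .
  qed
  have "\<exists>A. PSSL (cube d) C \<alpha> \<beta> \<epsilon> 0 (m + n) m A \<and> proper_learner (cube d) C (m + n) A"
  proof (rule net_learner)
    show "cube d \<noteq> {}" using card_cube[of d] by (metis card.empty power_not_zero zero_neq_numeral)
    show "finite C" by (rule finite_concept_class[OF C(1)]) simp
    show "real (card (traces C Y)) \<le> exp (\<alpha> / 64 / 16 * real (2 * k)) / (\<alpha> / 64 / 16) ^ v"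
      if "Y \<subseteq> cube d" "card Y \<le> 2 * k" for Y using that \<alpha> by (intro traces_le) auto
    show "(exp (\<alpha> / 64 / 16 * real (2 * k)) / (\<alpha> / 64 / 16) ^ v)\<^sup>2 < (1 + \<alpha> / 64) ^ k"
      using k_gt \<alpha> by (intro net_size) auto
    \<comment> \<open>Here \<open>x = \<alpha>\<close>: since \<open>\<alpha> * k\<close> is of
      order \<open>v * ln (1 / \<alpha>)\<close>, the number of labeled examples does not depend on
      \<open>d\<close>.\<close>
    show "real (card (traces C Y)) \<le> exp (\<alpha> * real k) / \<alpha> ^ v"
      if "Y \<subseteq> cube d" "card Y \<le> k" for Y using that \<alpha> by (intro traces_le) auto
    have "1 / \<alpha> ^ v = exp (real v * a)"
      using \<alpha> by (simp add: a_def exp_of_nat_mult power_one_over)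
    then have "exp (\<alpha> * real k) / \<alpha> ^ v = exp (\<alpha> * real k) * exp (real v * a)"
      by (metis times_divide_eq_right mult.right_neutral)
    then have "exp (\<alpha> * real k) / \<alpha> ^ v * exp (- (real m * \<epsilon> * \<alpha> / 4))
        = exp (\<alpha> * real k + real v * a - real m * \<epsilon> * \<alpha> / 4)"
      by (simp add: exp_add[symmetric])
    also have "\<dots> \<le> exp (- (1 + b))" using m_ge ea by (simp add: field_simps)
    also note half
    finally show "exp (\<alpha> * real k) / \<alpha> ^ v * exp (- (real m * \<epsilon> * \<alpha> / 4)) \<le> \<beta> / 2" .
    have two: "(2::real) ^ j \<le> exp (real j)" for j
    proof -
      have "(2::real) ^ j \<le> exp 1 ^ j" using exp_ge_add_one_self[of "1::real"] by (intro power_mono) auto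
      then show ?thesis by (simp add: exp_of_nat_mult[symmetric])
    qed
    have "real (card (cube d) ^ k) = 2 ^ (d * k)" by (simp add: power_mult)
    also have "\<dots> \<le> exp (real d * real k)" using two[of "d * k"] by simp
    finally have c1: "real (card (cube d) ^ k) \<le> exp (real d * real k)" .
    have "real (card C) \<le> exp 1 * 2 ^ (d * v)" unfolding v_def by (rule card_concept_class_cube[OF C(1)])
    also have "\<dots> \<le> exp 1 * exp (real d * real v)" using two[of "d * v"] by simp
    also have "\<dots> = exp (1 + real d * real v)" by (simp add: exp_add)
    finally have "(real (card C))\<^sup>2 \<le> (exp (1 + real d * real v))\<^sup>2" by (intro power_mono) auto
    also have "\<dots> = exp (2 + 2 * (real d * real v))" by (simp add: power2_eq_square exp_add[symmetric])
    finally have c2: "(real (card C))\<^sup>2 \<le> exp (2 + 2 * (real d * real v))" .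
    have "real (card (cube d) ^ k) * (real (card C))\<^sup>2 * exp (- (real n * \<epsilon> * \<alpha> / 32))
        \<le> exp (real d * real k) * exp (2 + 2 * (real d * real v)) * exp (- (real n * \<epsilon> * \<alpha> / 32))"
      using c1 c2 by (intro mult_right_mono mult_mono) auto
    also have "\<dots> = exp (real d * real k + (2 + 2 * (real d * real v)) - real n * \<epsilon> * \<alpha> / 32)"
      by (simp add: exp_add[symmetric])
    also have "\<dots> \<le> exp (- (1 + b))" using n_ge ea by (simp add: field_simps)
    also note half
    finally show "real (card (cube d) ^ k) * (real (card C))\<^sup>2 * exp (- (real n * \<epsilon> * \<alpha> / 32)) \<le> \<beta> / 2" .
  qed (use C eps \<alpha> in auto)
  then obtain A where A: "PSSL (cube d) C \<alpha> \<beta> \<epsilon> 0 (m + n) m A" "proper_learner (cube d) C (m + n) A" by blast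
  have "4 * (\<alpha> * real k + real v * a + 1 + b) / (\<epsilon> * \<alpha>) \<le> 4 * (real v * (5121 + 513 * a) + 1 + b) / (\<epsilon> * \<alpha>)"
    using k_alpha ea by (intro divide_right_mono) (auto simp: algebra_simps)
  then have m_bound: "real m \<le> 4 * (real v * (5121 + 513 * a) + 1 + b) / (\<epsilon> * \<alpha>) + 1" using m_le by linarith
  have "real d * real k + 2 * (real d * real v) \<le> real d * real v * (5123 + 512 * a) / \<alpha>"
  proof -
    have "\<alpha> * (real d * real k + 2 * (real d * real v)) = real d * (\<alpha> * real k) + 2 * \<alpha> * (real d * real v)"
      by (simp add: algebra_simps)
    also have "\<dots> \<le> real d * (real v * (5121 + 512 * a)) + 2 * (real d * real v)"
      using k_alpha \<alpha> by (intro add_mono mult_left_mono mult_right_mono) auto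
    also have "\<dots> = real d * real v * (5123 + 512 * a)" by (simp add: algebra_simps)
    finally show ?thesis using \<alpha> by (simp add: field_simps)
  qed
  then have "32 * (real d * real k + 2 * (real d * real v) + 3 + b) / (\<epsilon> * \<alpha>)
      \<le> 32 * (real d * real v * (5123 + 512 * a) / \<alpha> + 3 + b) / (\<epsilon> * \<alpha>)"
    using ea by (intro divide_right_mono) auto
  then have n_bound: "real n \<le> 32 * (real d * real v * (5123 + 512 * a) / \<alpha> + 3 + b) / (\<epsilon> * \<alpha>) + 1"
    using n_le by linarith
  show ?thesis using A m_bound n_bound unfolding a_def b_def by blast
qed

text \<open>The class has at most \<open>exp 1\<close> concepts here. The sizes in
  \<open>cube_learner\<close> would not fit the claim: for \<open>v = 0\<close> because of the term
  \<open>d * k\<close> with \<open>k \<ge> 1\<close>, for \<open>d = 0\<close> because the total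
  includes the labeled part.\<close>

lemma cube_learner_trivial:
  fixes C :: "(bool list \<Rightarrow> bool) set" and \<alpha> \<beta> \<epsilon> :: real
  assumes C: "concept_class (cube d) C" "C \<noteq> {}"
    and \<alpha>: "0 < \<alpha>" and \<beta>: "0 < \<beta>" and eps: "0 < \<epsilon>" "\<epsilon> \<le> 1"
    and dv: "d * vc_dim (cube d) C = 0"
    and b_nonneg: "0 \<le> ln (1 / \<beta>)"
  shows "\<exists>m A. PSSL (cube d) C \<alpha> \<beta> \<epsilon> 0 m m A \<and> proper_learner (cube d) C m A
    \<and> real m \<le> 4 * (1 + ln (1 / \<beta>)) / (\<epsilon> * \<alpha>) + 1"
proof -
  define b where "b = ln (1 / \<beta>)"
  have b: "0 \<le> b" "exp (- b) = \<beta>" using \<beta> b_nonneg by (simp_all add: b_def ln_div)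
  define m where "m = nat \<lceil>4 * (1 + b) / (\<epsilon> * \<alpha>)\<rceil>"
  have m_ge: "4 * (1 + b) / (\<epsilon> * \<alpha>) \<le> real m" and m_le: "real m \<le> 4 * (1 + b) / (\<epsilon> * \<alpha>) + 1"
    unfolding m_def using b \<alpha> eps by (auto intro!: nat_ceiling_bounds)
  have ea: "0 < \<epsilon> * \<alpha>" using eps \<alpha> by simp
  have "\<exists>A. PSSL (cube d) C \<alpha> \<beta> \<epsilon> 0 m m A \<and> proper_learner (cube d) C m A"
  proof (rule finite_class_learner)
    show "finite C" by (rule finite_concept_class[OF C(1)]) simp
    have "real (card C) \<le> exp 1" using card_concept_class_cube[OF C(1)] dv by simp
    then have "real (card C) * exp (- (real m * \<epsilon> * \<alpha> / 4)) \<le> exp 1 * exp (- (real m * \<epsilon> * \<alpha> / 4))"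
      by (intro mult_right_mono) auto
    also have "\<dots> = exp (1 - real m * \<epsilon> * \<alpha> / 4)" by (simp add: exp_add[symmetric])
    also have "\<dots> \<le> exp (- b)" using m_ge ea by (simp add: field_simps)
    finally show "real (card C) * exp (- (real m * \<epsilon> * \<alpha> / 4)) \<le> \<beta>" using b by simp
  qed (use C eps \<alpha> in auto)
  then show ?thesis using m_le unfolding b_def by blast
qed

text \<open>Passage to asymptotic form. Since \<open>a\<close> and \<open>b\<close> are at least
  \<open>L0\<close> and \<open>L1\<close>, additive constants become multiples of them; the
  \<open>+ 1\<close> from rounding is absorbed by \<open>\<epsilon>' * \<alpha> \<le> 1\<close>, and
  \<open>E\<close> pays for replacing \<open>\<epsilon>\<close> by \<open>\<epsilon>'\<close>. In
  \<open>K\<close>, 36 = 4 + 32 and 102 = 5 + 97 collect the constants of \<open>m\<close> and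
  \<open>n\<close>, with 5 = 4 + 1 and 97 = 32 * 3 + 1.\<close>

lemma size_bounds:
  fixes L0 L1 E \<alpha> \<epsilon> \<epsilon>' a b v d m n K :: real
  assumes L: "0 < L0" "L0 \<le> a" "0 < L1" "L1 \<le> b" and E: "1 \<le> E" "\<epsilon> \<le> E * \<epsilon>'" "0 < \<epsilon>" "0 < \<epsilon>'" "\<epsilon>' \<le> 1"
    and \<alpha>: "0 < \<alpha>" "\<alpha> \<le> 1" and dv: "0 \<le> v" "v \<le> d * v"
    and m: "m \<le> 4 * (v * (5121 + 513 * a) + 1 + b) / (\<epsilon>' * \<alpha>) + 1"
    and n: "n \<le> 32 * (d * v * (5123 + 512 * a) / \<alpha> + 3 + b) / (\<epsilon>' * \<alpha>) + 1"
    and K_def: "K = E * (36 * (5123 / L0 + 513) + 102 / L1 + 36)"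
  shows "m \<le> K * (v / (\<alpha> ^ 3 * \<epsilon>) * a + 1 / (\<alpha> * \<epsilon>) * b)"
    and "m + n \<le> K * (d * v / (\<alpha> ^ 3 * \<epsilon>) * a + 1 / (\<alpha> * \<epsilon>) * b)"
proof -
  define c where "c = 5123 / L0 + 513"
  define q where "q = E / (\<alpha> * \<epsilon>)"
  have c: "0 \<le> c" using L by (simp add: c_def)
  have a_pos: "0 < a" "0 < b" using L by auto
  have ca: "5123 + 513 * a \<le> c * a"
  proof -
    have "5123 \<le> 5123 / L0 * a" using L by (simp add: field_simps)
    then show ?thesis unfolding c_def by (simp add: algebra_simps)
  qed
  have ones: "1 \<le> b / L1" using L by simp
  have q: "1 / (\<epsilon>' * \<alpha>) \<le> q" "1 \<le> 1 / (\<epsilon>' * \<alpha>)" "0 < q"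
  proof -
    show "1 / (\<epsilon>' * \<alpha>) \<le> q" unfolding q_def using E \<alpha> by (simp add: field_simps)
    have "\<epsilon>' * \<alpha> \<le> 1 * 1" using E \<alpha> by (intro mult_mono) auto
    then show "1 \<le> 1 / (\<epsilon>' * \<alpha>)" using E \<alpha> by simp
    show "0 < q" using E \<alpha> by (simp add: q_def)
  qed
  have qmono: "x / (\<epsilon>' * \<alpha>) + 1 \<le> q * (x + 1)" if "0 \<le> x" for x
  proof -
    have "x * (1 / (\<epsilon>' * \<alpha>)) + 1 \<le> x * q + q"
      using q that by (intro add_mono mult_left_mono) auto
    then show ?thesis by (simp add: algebra_simps)
  qed
  have inv: "1 \<le> 1 / \<alpha>" "1 / \<alpha> \<le> 1 / \<alpha>\<^sup>2"
    using \<alpha> by (auto simp: field_simps power2_eq_square)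
  have m1: "m \<le> q * (4 * c * (v * a / \<alpha>\<^sup>2) + (5 / L1 + 4) * b)"
  proof -
    have "v * (5121 + 513 * a) \<le> v * (c * a)" using ca dv by (intro mult_left_mono) auto
    also have "\<dots> = c * (v * a) * 1" by simp
    also have "\<dots> \<le> c * (v * a) * (1 / \<alpha>\<^sup>2)" using inv c dv a_pos by (intro mult_left_mono) auto
    finally have "v * (5121 + 513 * a) \<le> c * (v * a) * (1 / \<alpha>\<^sup>2)" .
    moreover have "4 * c * (v * a / \<alpha>\<^sup>2) + (5 / L1 + 4) * b
        = 4 * (c * (v * a) * (1 / \<alpha>\<^sup>2)) + 5 * (b / L1) + 4 * b"
      by (simp add: algebra_simps)
    moreover have "4 * (x + 1 + b) + 1 \<le> z" if "x \<le> y" "z = 4 * y + 5 * (b / L1) + 4 * b" for x y z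
      using that ones by simp
    ultimately have "4 * (v * (5121 + 513 * a) + 1 + b) + 1 \<le> 4 * c * (v * a / \<alpha>\<^sup>2) + (5 / L1 + 4) * b"
      by blast
    then have "q * (4 * (v * (5121 + 513 * a) + 1 + b) + 1) \<le> q * (4 * c * (v * a / \<alpha>\<^sup>2) + (5 / L1 + 4) * b)"
      using q by (intro mult_left_mono) auto
    moreover have "0 \<le> 4 * (v * (5121 + 513 * a) + 1 + b)" using dv a_pos by simp
    ultimately show ?thesis using m qmono by fastforce
  qed
  have n1: "n \<le> q * (32 * c * (d * v * a / \<alpha>\<^sup>2) + (97 / L1 + 32) * b)"
  proof -
    have dv0: "0 \<le> d * v" using dv by linarith
    have "d * v * (5123 + 512 * a) \<le> d * v * (c * a)" using ca dv0 a_pos by (intro mult_left_mono) auto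
    then have "d * v * (5123 + 512 * a) / \<alpha> \<le> c * (d * v * a) * (1 / \<alpha>)"
      using \<alpha> by (simp add: divide_right_mono mult.left_commute mult.assoc)
    also have "\<dots> \<le> c * (d * v * a) * (1 / \<alpha>\<^sup>2)" using inv c dv0 a_pos by (intro mult_left_mono) auto
    finally have "d * v * (5123 + 512 * a) / \<alpha> \<le> c * (d * v * a) * (1 / \<alpha>\<^sup>2)" .
    moreover have "32 * c * (d * v * a / \<alpha>\<^sup>2) + (97 / L1 + 32) * b
        = 32 * (c * (d * v * a) * (1 / \<alpha>\<^sup>2)) + 97 * (b / L1) + 32 * b"
      by (simp add: algebra_simps)
    moreover have "32 * (x + 3 + b) + 1 \<le> z" if "x \<le> y" "z = 32 * y + 97 * (b / L1) + 32 * b" for x y z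
      using that ones by simp
    ultimately have "32 * (d * v * (5123 + 512 * a) / \<alpha> + 3 + b) + 1 \<le> 32 * c * (d * v * a / \<alpha>\<^sup>2) + (97 / L1 + 32) * b"
      by blast
    then have "q * (32 * (d * v * (5123 + 512 * a) / \<alpha> + 3 + b) + 1) \<le> q * (32 * c * (d * v * a / \<alpha>\<^sup>2) + (97 / L1 + 32) * b)"
      using q by (intro mult_left_mono) auto
    moreover have "0 \<le> 32 * (d * v * (5123 + 512 * a) / \<alpha> + 3 + b)" using dv0 a_pos \<alpha> by simp
    ultimately show ?thesis using n qmono by fastforce
  qed
  have K: "K = E * (36 * c + (102 / L1 + 36))" by (simp add: K_def c_def)
  have final: "q * (x * (w * a / \<alpha>\<^sup>2) + y * b) \<le> K * (w / (\<alpha> ^ 3 * \<epsilon>) * a + 1 / (\<alpha> * \<epsilon>) * b)"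
    if "0 \<le> w" "x \<le> 36 * c" "y \<le> 102 / L1 + 36" "0 \<le> x" "0 \<le> y" for x w y
  proof -
    have "x * (w * a / \<alpha>\<^sup>2) + y * b
        \<le> (36 * c + (102 / L1 + 36)) * (w * a / \<alpha>\<^sup>2) + (36 * c + (102 / L1 + 36)) * b"
      using that c L a_pos by (intro add_mono mult_right_mono) auto
    then have "q * (x * (w * a / \<alpha>\<^sup>2) + y * b) \<le> q * ((36 * c + (102 / L1 + 36)) * (w * a / \<alpha>\<^sup>2 + b))"
      using q by (intro mult_left_mono) (auto simp: algebra_simps)
    also have "\<dots> = K * (w / (\<alpha> ^ 3 * \<epsilon>) * a + 1 / (\<alpha> * \<epsilon>) * b)"
      unfolding K q_def using \<alpha> E by (simp add: field_simps power2_eq_square power3_eq_cube)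
    finally show ?thesis .
  qed
  have "5 / L1 \<le> 102 / L1" using L by (intro divide_right_mono) auto
  then have L1: "5 / L1 + 4 \<le> 102 / L1 + 36" by (rule add_mono) simp
  have L1_nonneg: "0 \<le> 5 / L1 + 4" "0 \<le> 102 / L1 + 36" using L by auto
  show "m \<le> K * (v / (\<alpha> ^ 3 * \<epsilon>) * a + 1 / (\<alpha> * \<epsilon>) * b)"
    using m1 by (rule order_trans) (intro final dv L1 L1_nonneg, use c in auto)
  have le: "q * (4 * c * (v * a / \<alpha>\<^sup>2) + (5 / L1 + 4) * b) \<le> q * (4 * c * (d * v * a / \<alpha>\<^sup>2) + (5 / L1 + 4) * b)"
    using dv q c a_pos by (intro mult_left_mono add_right_mono divide_right_mono mult_right_mono) auto
  have "m + n \<le> q * (36 * c * (d * v * a / \<alpha>\<^sup>2) + (102 / L1 + 36) * b)"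
  proof -
    have L1_sum: "102 / L1 = 5 / L1 + 97 / L1" by (simp add: add_divide_distrib[symmetric])
    have "q * (4 * c * w + (x + 4) * b) + q * (32 * c * w + (y + 32) * b)
        = q * (36 * c * w + ((x + y) + 36) * b)" for w x y
      by (simp add: algebra_simps)
    note this[of "d * v * a / \<alpha>\<^sup>2" "5 / L1" "97 / L1", folded L1_sum]
    then show ?thesis using le m1 n1 by linarith
  qed
  then show "m + n \<le> K * (d * v / (\<alpha> ^ 3 * \<epsilon>) * a + 1 / (\<alpha> * \<epsilon>) * b)"
    by (rule order_trans) (intro final order_refl L1_nonneg order_trans[OF dv], use c in auto)
qed

text \<open>The asymptotic bound is read uniformly: \<open>K\<close> is chosen before
  \<open>d\<close>, \<open>C\<close> and the parameters. The caps \<open>\<alpha>\<^sub>0\<close>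
  and \<open>\<beta>\<^sub>0\<close> below 1 keep both logarithms away from 0, so that they dominate
  constants and rounding.\<close>

theorem theorem3p3:
  fixes \<alpha>\<^sub>0 \<beta>\<^sub>0 \<epsilon>\<^sub>0 :: real
  assumes "0 < \<alpha>\<^sub>0" "\<alpha>\<^sub>0 < 1" "0 < \<beta>\<^sub>0" "\<beta>\<^sub>0 < 1" "0 < \<epsilon>\<^sub>0"
  shows "\<exists>K > 0. \<forall>(d::nat) (C :: (bool list \<Rightarrow> bool) set) (\<alpha>::real) (\<beta>::real) (\<epsilon>::real).
    concept_class (cube d) C \<and> C \<noteq> {} \<and>
    0 < \<alpha> \<and> \<alpha> \<le> \<alpha>\<^sub>0 \<and> 0 < \<beta> \<and> \<beta> \<le> \<beta>\<^sub>0 \<and> 0 < \<epsilon> \<and> \<epsilon> \<le> \<epsilon>\<^sub>0 \<longrightarrow>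
    (\<exists>(n::nat) (m::nat) (A :: bool list learner).
       PSSL (cube d) C \<alpha> \<beta> \<epsilon> 0 n m A \<and>
       proper_learner (cube d) C n A \<and>
       real m \<le> K * (real (vc_dim (cube d) C) / (\<alpha> ^ 3 * \<epsilon>) * ln (1 / \<alpha>)
                      + 1 / (\<alpha> * \<epsilon>) * ln (1 / \<beta>)) \<and>
       real n \<le> K * (real d * real (vc_dim (cube d) C) / (\<alpha> ^ 3 * \<epsilon>) * ln (1 / \<alpha>)
                      + 1 / (\<alpha> * \<epsilon>) * ln (1 / \<beta>)))"
proof -
  define L0 L1 E where "L0 = ln (1 / \<alpha>\<^sub>0)" and "L1 = ln (1 / \<beta>\<^sub>0)" and "E = max 1 \<epsilon>\<^sub>0"
  define K where "K = E * (36 * (5123 / L0 + 513) + 102 / L1 + 36)"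
  have L: "0 < L0" "0 < L1" using assms by (auto simp: L0_def L1_def)
  have E: "1 \<le> E" by (simp add: E_def)
  show ?thesis
  proof (intro exI[of _ K] conjI allI impI, goal_cases)
    case 1
    have "0 < 36 * (5123 / L0 + 513) + 102 / L1 + 36"
      using L by (intro add_pos_pos mult_pos_pos divide_pos_pos) auto
    then show ?case using E by (simp add: K_def)
  next
    case (2 d C \<alpha> \<beta> \<epsilon>)
    then have C: "concept_class (cube d) C" "C \<noteq> {}" and \<alpha>: "0 < \<alpha>" "\<alpha> \<le> \<alpha>\<^sub>0" and \<beta>: "0 < \<beta>" "\<beta> \<le> \<beta>\<^sub>0"
      and \<epsilon>: "0 < \<epsilon>" "\<epsilon> \<le> \<epsilon>\<^sub>0" by auto
    define v where "v = vc_dim (cube d) C"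
    \<comment> \<open>The mechanism is analyzed for privacy parameters up to 1. Privacy for
      \<open>\<epsilon>'\<close> implies privacy for \<open>\<epsilon>\<close>, and the sample grows
      by a factor of at most \<open>E\<close>.\<close>
    define \<epsilon>' where "\<epsilon>' = min \<epsilon> 1"
    have \<epsilon>': "0 < \<epsilon>'" "\<epsilon>' \<le> 1" "\<epsilon>' \<le> \<epsilon>" using \<epsilon> by (auto simp: \<epsilon>'_def)
    have E': "\<epsilon> \<le> E * \<epsilon>'"
    proof (cases "\<epsilon> \<le> 1")
      case True
      then show ?thesis using mult_right_mono[OF E, of \<epsilon>] \<epsilon> by (simp add: \<epsilon>'_def)
    next
      case False
      then show ?thesis using \<epsilon> by (simp add: \<epsilon>'_def E_def)
    qed
    have a: "L0 \<le> ln (1 / \<alpha>)" using \<alpha> by (simp add: L0_def ln_div)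
    have b: "L1 \<le> ln (1 / \<beta>)" using \<beta> by (simp add: L1_def ln_div)
    have \<alpha>1: "\<alpha> < 1" using \<alpha> assms by simp
    have b0: "0 \<le> ln (1 / \<beta>)" using b L by simp
    show ?case
    proof (cases "d * v = 0")
      case True
      obtain m A where m: "PSSL (cube d) C \<alpha> \<beta> \<epsilon>' 0 m m A" "proper_learner (cube d) C m A"
        "real m \<le> 4 * (1 + ln (1 / \<beta>)) / (\<epsilon>' * \<alpha>) + 1"
        using cube_learner_trivial[OF C \<alpha>(1) \<beta>(1) \<epsilon>'(1,2) True[unfolded v_def] b0] by blast
      have dv: "real d * real v = 0" using True by (metis of_nat_0 of_nat_mult)
      \<comment> \<open>Instantiated with VC dimension 0, since the trivial learner pays only for
        \<open>\<beta>\<close>; the nonnegative VC term is added afterwards.\<close>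
      have "real m \<le> K * (0 / (\<alpha> ^ 3 * \<epsilon>) * ln (1 / \<alpha>) + 1 / (\<alpha> * \<epsilon>) * ln (1 / \<beta>))"
        by (rule size_bounds(1)[OF _ _ _ _ _ _ _ _ _ _ _ _ _ _ _ K_def, where d = 0 and n = 0 and \<epsilon>' = \<epsilon>']) (use L a b E E' \<epsilon> \<epsilon>' \<alpha> \<alpha>1 m(3) b0 in auto)
      moreover have "0 \<le> K * (real v / (\<alpha> ^ 3 * \<epsilon>) * ln (1 / \<alpha>))"
        using L E a \<alpha> \<alpha>1 \<epsilon> unfolding K_def
        by (intro mult_nonneg_nonneg add_nonneg_nonneg divide_nonneg_nonneg) auto
      ultimately have "real m \<le> K * (real v / (\<alpha> ^ 3 * \<epsilon>) * ln (1 / \<alpha>) + 1 / (\<alpha> * \<epsilon>) * ln (1 / \<beta>))"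
        "real m \<le> K * (real d * real v / (\<alpha> ^ 3 * \<epsilon>) * ln (1 / \<alpha>) + 1 / (\<alpha> * \<epsilon>) * ln (1 / \<beta>))"
        unfolding dv by (simp_all add: distrib_left)
      then show ?thesis using PSSL_mono_privacy[OF m(1) \<epsilon>'(3)] m(2) unfolding v_def by blast
    next
      case False
      then have dv: "1 \<le> d" "1 \<le> v" by auto
      obtain n m A where A: "PSSL (cube d) C \<alpha> \<beta> \<epsilon>' 0 (m + n) m A" "proper_learner (cube d) C (m + n) A"
        and m: "real m \<le> 4 * (real v * (5121 + 513 * ln (1 / \<alpha>)) + 1 + ln (1 / \<beta>)) / (\<epsilon>' * \<alpha>) + 1"
        and n: "real n \<le> 32 * (real d * real v * (5123 + 512 * ln (1 / \<alpha>)) / \<alpha> + 3 + ln (1 / \<beta>)) / (\<epsilon>' * \<alpha>) + 1"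
        using cube_learner[OF v_def C \<alpha>(1) \<alpha>1 \<beta>(1) \<epsilon>'(1,2) dv(2) b0] by blast
      \<comment> \<open>Lets the labeled entries fit under the bound on the total
        \<open>m + n\<close>.\<close>
      have "real v \<le> real d * real v" using dv mult_right_mono[of 1 "real d" "real v"] by simp
      note sz = size_bounds[OF L(1) a L(2) b E E' \<epsilon>(1) \<epsilon>'(1,2) \<alpha>(1) less_imp_le[OF \<alpha>1] of_nat_0_le_iff this m n K_def]
      show ?thesis using PSSL_mono_privacy[OF A(1) \<epsilon>'(3)] A(2) sz unfolding v_def of_nat_add[symmetric] by blast
    qed
  qed
qed

end
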